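(* Let $0<a<b<\infty$, $1<p,q<\infty$, $\alpha\in\left(1-\frac1q,1\right)$, $0<r<\infty$ and $p+q\geq r$. Let $\delta\in[0,1]\cap\left[\frac{r-q}{r},\frac pr\right]$ and $c,d,e\in\mathbb{R}$ be such that $$\frac{\delta}{p}+\frac{1-\delta}{q}=\frac1r,\qquad c=\delta(d-1)+e(1-\delta),\qquad 1+(d-1)p>0.$$ Then there is a constant $C>0$, independent of $u$, such that for every $u\in AC[a,b]$ with $u(a)=0$, $$\|x^{c}u\|_{L^{r}(a,b)}\leq C\,\|x^{d}\,\partial^{\alpha}_{a+}u\|^{\delta}_{L^{p}(a,b)}\,\|x^{e}u\|^{1-\delta}_{L^{q}(a,b)},$$ where $\partial^\alpha_{a+}$ is the left Caputo fractional derivative of order $\alpha$.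
   Context: $AC[a,b]$ is the space of (real- or complex-valued) absolutely continuous functions on $[a,b]$, $x$ denotes the variable in $(a,b)$, and $\Gamma$ is the Euler gamma function. For $\alpha>0$ the left Riemann--Liouville integral is $I_{a+}^\alpha f(t)=\frac{1}{\Gamma(\alpha)}\int_a^t (t-s)^{\alpha-1}f(s)\,ds$, $t\in(a,b]$. For $0<\alpha< 1$ and $f\in AC[a,b]$ the left Caputo fractional derivative is $\partial_{a+}^\alpha f(t)=I_{a+}^{1-\alpha}f'(t)$ (defined for almost every $t$). Norms take values in $[0,\infty]$ (so the inequality has content only if the right-hand side is finite), and any quantity raised to the power $0$ is $1$. For $r>0$, $\|u\|_{L^r(a,b)}=\left(\int_a^b|u|^r\,dx\right)^{1/r}$. *)

theory Defs
  imports "HOL-Analysis.Analysis"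
begin

definition absolutely_continuous_on :: "real \<Rightarrow> real \<Rightarrow> (real \<Rightarrow> 'a::real_normed_vector) \<Rightarrow> bool" where
  "absolutely_continuous_on a b f \<longleftrightarrow>
     (\<forall>\<epsilon>>0. \<exists>\<eta>>0. \<forall>(n::nat) x y.
        (\<forall>i<n. a \<le> x i \<and> x i \<le> y i \<and> y i \<le> b) \<and>
        disjoint_family_on (\<lambda>i. {x i<..<y i}) {..<n} \<and>
        (\<Sum>i<n. y i - x i) < \<eta>
        \<longrightarrow> (\<Sum>i<n. norm (f (y i) - f (x i))) < \<epsilon>)"

definition left_RL_integral ::
    "real \<Rightarrow> real \<Rightarrow> (real \<Rightarrow> 'a::{banach, second_countable_topology}) \<Rightarrow> real \<Rightarrow> 'a" where
  "left_RL_integral \<alpha> a f t =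
     (1 / Gamma \<alpha>) *\<^sub>R (LINT s:{a..t}|lebesgue. ((t - s) powr (\<alpha> - 1)) *\<^sub>R f s)"

(* Meant for 0 < \<alpha> < 1 and f absolutely continuous on [a,b]. Then f is differentiable at almost
   every s, and the integral converges absolutely for almost every t in (a,b); on the exceptional
   null sets the library's default values are used, which no L^p norm detects. *)
definition left_Caputo_deriv ::
    "real \<Rightarrow> real \<Rightarrow> (real \<Rightarrow> 'a::{banach, second_countable_topology}) \<Rightarrow> real \<Rightarrow> 'a" where
  "left_Caputo_deriv \<alpha> a f t =
     left_RL_integral (1 - \<alpha>) a (\<lambda>s. vector_derivative f (at s)) t"

(* Power of an element of [0,\<infinity>] with exponent s \<ge> 0 (the only case used).
   The convention is that every quantity to the power 0 is 1, in contrast to 0 powr 0 = 0. *)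
definition ennreal_powr :: "ennreal \<Rightarrow> real \<Rightarrow> ennreal" where
  "ennreal_powr x s =
     (if s = 0 then 1 else if x = \<infinity> then \<infinity> else ennreal (enn2real x powr s))"

definition Lp_norm :: "real \<Rightarrow> real \<Rightarrow> real \<Rightarrow> (real \<Rightarrow> 'a::real_normed_vector) \<Rightarrow> ennreal" where
  "Lp_norm r a b u =
     ennreal_powr (\<integral>\<^sup>+ x\<in>{a<..<b}. ennreal (norm (u x) powr r) \<partial>lebesgue) (1 / r)"

end

theory Submission
  imports Defs
begin

text \<open>
  On \<open>[a, b]\<close> with \<open>0 < a\<close> all power weights are bounded above and below by positive constants, so
  the claim reduces to the unweighted inequality. Hoelder's inequality gives
  \<open>\<parallel>u\<parallel>\<^sub>r \<le> \<parallel>u\<parallel>\<^sub>p powr \<delta> * \<parallel>u\<parallel>\<^sub>q powr (1 - \<delta>)\<close>. Since \<open>u a = 0\<close>, absolute continuity gives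
  \<open>u = I\<^sup>1 u'\<close>, and the Beta integral turns this into \<open>u = I\<^sup>\<alpha> (I\<^sup>1\<^sup>-\<^sup>\<alpha> u')\<close>, the fractional integral
  of the Caputo derivative; as the kernel of \<open>I\<^sup>\<alpha>\<close> is integrable, Young's inequality bounds
  \<open>\<parallel>u\<parallel>\<^sub>p\<close> by the \<open>L\<^sup>p\<close> norm of that derivative.

  The fundamental theorem of calculus for an absolutely continuous real \<open>f\<close> is obtained by writing
  \<open>f = V - (V - f)\<close> with the total variation \<open>V\<close>: both terms are monotone and their Stieltjes
  measures are absolutely continuous, so they have Radon-Nikodym densities, and Lebesgue's
  differentiation theorem identifies the density of \<open>f\<close> with the derivative almost everywhere.
\<close>

section \<open>The total variation of an absolutely continuous function\<close>

text \<open>A family is a finite set of endpoint pairs, not an indexed list as in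
  \<open>absolutely_continuous_on\<close>, so that it can be refined by unions and images.
  Degenerate intervals are excluded, so distinct members have distinct left endpoints; neighbours
  may share an endpoint.\<close>

definition nonoverlapping :: "real \<Rightarrow> real \<Rightarrow> (real \<times> real) set \<Rightarrow> bool" where
  "nonoverlapping s t S \<longleftrightarrow> finite S \<and> (\<forall>(x, y)\<in>S. s \<le> x \<and> x < y \<and> y \<le> t) \<and>
     (\<forall>(x, y)\<in>S. \<forall>(x', y')\<in>S. (x, y) \<noteq> (x', y') \<longrightarrow> y \<le> x' \<or> y' \<le> x)"

definition total_length :: "(real \<times> real) set \<Rightarrow> real" where
  "total_length S = (\<Sum>(x, y)\<in>S. y - x)"

definition variation_sum :: "(real \<Rightarrow> 'a::real_normed_vector) \<Rightarrow> (real \<times> real) set \<Rightarrow> real" where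
  "variation_sum f S = (\<Sum>(x, y)\<in>S. norm (f y - f x))"

text \<open>The bound is \<open>\<le> \<epsilon>\<close> and not strict, so that it survives the
  suprema by which the estimate passes from \<open>f\<close> to its total variation.\<close>

definition small_variation :: "real \<Rightarrow> real \<Rightarrow> (real \<Rightarrow> 'a::real_normed_vector) \<Rightarrow> bool" where
  "small_variation a b f \<longleftrightarrow>
     (\<forall>\<epsilon>>0. \<exists>\<eta>>0. \<forall>S. nonoverlapping a b S \<and> total_length S < \<eta> \<longrightarrow> variation_sum f S \<le> \<epsilon>)"

lemma nonoverlapping_finite: "nonoverlapping s t S \<Longrightarrow> finite S"
  by (simp add: nonoverlapping_def)

lemma nonoverlappingD:
  assumes "nonoverlapping s t S" "(x, y) \<in> S"
  shows "s \<le> x" "x < y" "y \<le> t"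
  using assms by (auto simp: nonoverlapping_def)

lemma nonoverlapping_disjD:
  assumes "nonoverlapping s t S" "(x, y) \<in> S" "(x', y') \<in> S" "(x, y) \<noteq> (x', y')"
  shows "y \<le> x' \<or> y' \<le> x"
  using assms unfolding nonoverlapping_def by fast

lemma nonoverlappingI:
  assumes "finite S" "\<And>x y. (x, y) \<in> S \<Longrightarrow> s \<le> x \<and> x < y \<and> y \<le> t"
    and "\<And>x y x' y'. (x, y) \<in> S \<Longrightarrow> (x', y') \<in> S \<Longrightarrow> (x, y) \<noteq> (x', y') \<Longrightarrow> \<not> y' \<le> x \<Longrightarrow> y \<le> x'"
  shows "nonoverlapping s t S"
  unfolding nonoverlapping_def using assms by fast

lemma nonoverlapping_empty [simp]: "nonoverlapping s t {}"
  by (simp add: nonoverlapping_def)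

lemma nonoverlapping_nonempty: "Collect (nonoverlapping s t) \<noteq> {}"
  using nonoverlapping_empty by blast

lemma nonoverlapping_mono:
  "nonoverlapping s t S \<Longrightarrow> s' \<le> s \<Longrightarrow> t \<le> t' \<Longrightarrow> nonoverlapping s' t' S"
  by (fastforce simp: nonoverlapping_def)

lemma variation_sum_nonneg: "0 \<le> variation_sum f S"
  by (auto simp: variation_sum_def intro!: sum_nonneg)

lemma nonoverlapping_disjoint_family:
  assumes "nonoverlapping s t S"
  shows "disjoint_family_on (\<lambda>(x, y). {x<..<y}) S"
  unfolding disjoint_family_on_def
proof (intro ballI impI)
  fix p p' assume "p \<in> S" "p' \<in> S" "p \<noteq> p'"
  then show "(case p of (x, y) \<Rightarrow> {x<..<y}) \<inter> (case p' of (x, y) \<Rightarrow> {x<..<y}) = {}"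
    using nonoverlapping_disjD[OF assms, of "fst p" "snd p" "fst p'" "snd p'"]
    by (fastforce simp: case_prod_beta prod_eq_iff)
qed

text \<open>Only the encoding changes: enumerating the finite set \<open>S\<close> by a bijection
  with \<open>{..<card S}\<close> turns it into the indexed intervals of the definition.\<close>

lemma absolutely_continuous_on_small_variation:
  assumes "absolutely_continuous_on a b f"
  shows "small_variation a b f"
  unfolding small_variation_def
proof (intro allI impI)
  fix \<epsilon> :: real assume "\<epsilon> > 0"
  then obtain \<eta> where "\<eta> > 0" and \<eta>0: "\<forall>(n::nat) x y.
        (\<forall>i<n. a \<le> x i \<and> x i \<le> y i \<and> y i \<le> b) \<and>
        disjoint_family_on (\<lambda>i. {x i<..<y i}) {..<n} \<and>
        (\<Sum>i<n. y i - x i) < \<eta> \<longrightarrow> (\<Sum>i<n. norm (f (y i) - f (x i))) < \<epsilon>"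
    using assms unfolding absolutely_continuous_on_def by blast
  note \<eta> = \<eta>0[rule_format, OF conjI, OF _ conjI]
  show "\<exists>\<eta>>0. \<forall>S. nonoverlapping a b S \<and> total_length S < \<eta> \<longrightarrow> variation_sum f S \<le> \<epsilon>"
  proof (intro exI[of _ \<eta>] conjI allI impI \<open>\<eta> > 0\<close>)
    fix S assume S: "nonoverlapping a b S \<and> total_length S < \<eta>"
    obtain h where h: "bij_betw h {..<card S} S"
      using ex_bij_betw_nat_finite[OF nonoverlapping_finite[of a b S]] S
      by (auto simp: atLeast0LessThan)
    have hS: "(fst (h i), snd (h i)) \<in> S" if "i < card S" for i
      using h that by (auto simp: bij_betw_def)
    have "(\<Sum>i<card S. norm (f (snd (h i)) - f (fst (h i)))) < \<epsilon>"
    proof (rule \<eta>)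
      show "\<forall>i<card S. a \<le> fst (h i) \<and> fst (h i) \<le> snd (h i) \<and> snd (h i) \<le> b"
        using nonoverlappingD[OF _ hS] S by (meson less_imp_le)
      show "disjoint_family_on (\<lambda>i. {fst (h i)<..<snd (h i)}) {..<card S}"
        unfolding disjoint_family_on_def
      proof (intro ballI impI)
        fix i j assume "i \<in> {..<card S}" "j \<in> {..<card S}" "i \<noteq> j"
        then have "h i \<in> S" "h j \<in> S" "h i \<noteq> h j"
          using h by (auto simp: bij_betw_def inj_on_def)
        then show "{fst (h i)<..<snd (h i)} \<inter> {fst (h j)<..<snd (h j)} = {}"
          using nonoverlapping_disjoint_family[of a b S] S
          by (simp add: disjoint_family_on_def case_prod_beta)
      qed
      show "(\<Sum>i<card S. snd (h i) - fst (h i)) < \<eta>"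
        using S sum.reindex_bij_betw[OF h, of "\<lambda>(x, y). y - x"]
        by (simp add: total_length_def case_prod_beta)
    qed
    then show "variation_sum f S \<le> \<epsilon>"
      using sum.reindex_bij_betw[OF h, of "\<lambda>(x, y). norm (f y - f x)"]
      by (simp add: variation_sum_def case_prod_beta)
  qed
qed

text \<open>The open intervals are disjoint subsets of \<open>{s..t}\<close>, so additivity of
  Lebesgue measure bounds the sum of their lengths.\<close>

lemma total_length_le:
  assumes "nonoverlapping s t S" "s \<le> t"
  shows "total_length S \<le> t - s"
proof -
  have "ennreal (total_length S) = (\<Sum>p\<in>S. ennreal (snd p - fst p))"
    using nonoverlappingD(2)[OF assms(1)] unfolding total_length_def
    by (subst sum_ennreal) (auto simp: case_prod_beta less_imp_le)
  also have "\<dots> = (\<Sum>p\<in>S. emeasure lborel (case p of (x, y) \<Rightarrow> {x<..<y}))"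
    using nonoverlappingD(2)[OF assms(1)]
    by (intro sum.cong) (auto simp: less_imp_le)
  also have "\<dots> = emeasure lborel (\<Union>p\<in>S. case p of (x, y) \<Rightarrow> {x<..<y})"
    by (intro sum_emeasure nonoverlapping_disjoint_family[OF assms(1)]
         nonoverlapping_finite[OF assms(1)]) auto
  also have "\<dots> \<le> emeasure lborel {s..t}"
    using nonoverlappingD[OF assms(1)] by (intro emeasure_mono) force+
  finally show ?thesis
    using assms(2) by simp
qed

section \<open>Total variation over an interval\<close>

text \<open>Valued in \<open>ennreal\<close>, so that the supremum exists before it is known to be
  finite.\<close>

definition tot_var :: "(real \<Rightarrow> 'a::real_normed_vector) \<Rightarrow> real \<Rightarrow> real \<Rightarrow> ennreal" where
  "tot_var f s t = (SUP S\<in>Collect (nonoverlapping s t). ennreal (variation_sum f S))"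

lemma variation_sum_le_tot_var:
  "nonoverlapping s t S \<Longrightarrow> ennreal (variation_sum f S) \<le> tot_var f s t"
  unfolding tot_var_def by (auto intro: SUP_upper)

lemma variation_sum_insert:
  "finite S \<Longrightarrow> (x, y) \<notin> S \<Longrightarrow> variation_sum f (insert (x, y) S) = norm (f y - f x) + variation_sum f S"
  by (simp add: variation_sum_def)

text \<open>Any family in \<open>{s..m}\<close> can be extended by the interval from
  \<open>m\<close> to \<open>t\<close>; take the supremum. For \<open>m = t\<close> that interval
  would be degenerate, hence the case split. This half of additivity later makes the variation, and
  its difference with the function, nondecreasing.\<close>

lemma tot_var_add_le:
  assumes "s \<le> m" "m \<le> t"
  shows "tot_var f s m + ennreal (norm (f t - f m)) \<le> tot_var f s t"
proof (cases "m = t")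
  case False
  have "(SUP S\<in>Collect (nonoverlapping s m). ennreal (variation_sum f S) + ennreal (norm (f t - f m)))
      \<le> tot_var f s t"
  proof (rule SUP_least)
    fix S assume "S \<in> Collect (nonoverlapping s m)"
    then have S: "nonoverlapping s m S" by simp
    have notin: "(m, t) \<notin> S"
      using nonoverlappingD[OF S, of m t] assms False by auto
    have "nonoverlapping s t (insert (m, t) S)"
      using S assms False unfolding nonoverlapping_def by fastforce
    from variation_sum_le_tot_var[OF this, of f]
    show "ennreal (variation_sum f S) + ennreal (norm (f t - f m)) \<le> tot_var f s t"
      using notin nonoverlapping_finite[OF S]
      by (simp add: variation_sum_insert ennreal_plus variation_sum_nonneg add.commute)
  qed
  then show ?thesis
    unfolding ennreal_SUP_add_left[OF nonoverlapping_nonempty] tot_var_def[symmetric] .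
qed simp

text \<open>Cutting a family at \<open>m\<close> cannot lower its variation sum, by the triangle
  inequality through \<open>f m\<close>.\<close>

lemma tot_var_le_add:
  assumes "s \<le> m" "m \<le> t"
  shows "tot_var f s t \<le> tot_var f s m + tot_var f m t"
  unfolding tot_var_def[of f s t]
proof (rule SUP_least)
  fix S assume "S \<in> Collect (nonoverlapping s t)"
  then have S: "nonoverlapping s t S" by simp
  \<comment> \<open>\<open>A\<close> holds the intervals that start before \<open>m\<close>, and
    \<open>?l\<close> shortens them to end by \<open>m\<close>; \<open>B\<close> and
    \<open>?r\<close> do the same on the right. An interval straddling \<open>m\<close> lies in
    both.\<close>
  define A where "A = {p\<in>S. fst p < m}"
  define B where "B = {p\<in>S. m < snd p}"
  let ?l = "\<lambda>(x::real, y). (x, min y m)" and ?r = "\<lambda>(x::real, y). (max x m, y)"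
  note D = nonoverlappingD[OF S] and E = nonoverlapping_disjD[OF S]
  have fin: "finite S" "finite A" "finite B"
    using nonoverlapping_finite[OF S] by (auto simp: A_def B_def)
  \<comment> \<open>Cut intervals stay distinct: a common left endpoint would already make the
    original intervals overlap.\<close>
  have injl: "inj_on ?l A"
  proof (rule inj_onI)
    fix p p' assume "p \<in> A" "p' \<in> A" "?l p = ?l p'"
    then show "p = p'"
      using E[of "fst p" "snd p" "fst p'" "snd p'"] D[of "fst p" "snd p"] D[of "fst p'" "snd p'"]
      by (cases p; cases p') (auto simp: A_def)
  qed
  have injr: "inj_on ?r B"
  proof (rule inj_onI)
    fix p p' assume "p \<in> B" "p' \<in> B" "?r p = ?r p'"
    then show "p = p'"
      using E[of "fst p" "snd p" "fst p'" "snd p'"] D[of "fst p" "snd p"] D[of "fst p'" "snd p'"]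
      by (cases p; cases p') (auto simp: B_def)
  qed
  have l: "nonoverlapping s m (?l ` A)"
    unfolding nonoverlapping_def
  proof (intro conjI ballI)
    show "finite (?l ` A)" using fin by simp
    fix p assume "p \<in> ?l ` A"
    then obtain x y where p: "(x, y) \<in> S" "x < m" "p = (x, min y m)"
      by (auto simp: A_def)
    show "case p of (x, y) \<Rightarrow> s \<le> x \<and> x < y \<and> y \<le> m"
      using p D[of x y] by auto
    show "case p of (x, y) \<Rightarrow> \<forall>(x', y')\<in>?l ` A. (x, y) \<noteq> (x', y') \<longrightarrow> y \<le> x' \<or> y' \<le> x"
    proof (simp add: p, intro ballI, clarsimp)
      fix x' y' assume "(x', y') \<in> A" "x = x' \<longrightarrow> min y m \<noteq> min y' m"
        "\<not> min y' m \<le> x"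
      moreover from this have "(x, y) \<noteq> (x', y')" by auto
      ultimately show "min y m \<le> x'"
        using E[of x y x' y'] p by (auto simp: A_def)
    qed
  qed
  have r: "nonoverlapping m t (?r ` B)"
    unfolding nonoverlapping_def
  proof (intro conjI ballI)
    show "finite (?r ` B)" using fin by simp
    fix p assume "p \<in> ?r ` B"
    then obtain x y where p: "(x, y) \<in> S" "m < y" "p = (max x m, y)"
      by (auto simp: B_def)
    show "case p of (x, y) \<Rightarrow> m \<le> x \<and> x < y \<and> y \<le> t"
      using p D[of x y] by auto
    show "case p of (x, y) \<Rightarrow> \<forall>(x', y')\<in>?r ` B. (x, y) \<noteq> (x', y') \<longrightarrow> y \<le> x' \<or> y' \<le> x"
    proof (simp add: p, intro ballI, clarsimp)
      fix x' y' assume "(x', y') \<in> B" "max x m = max x' m \<longrightarrow> y \<noteq> y'"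
        "\<not> y' \<le> max x m"
      moreover from this have "(x, y) \<noteq> (x', y')" by auto
      ultimately show "y \<le> max x' m"
        using E[of x y x' y'] p by (auto simp: B_def)
    qed
  qed
  \<comment> \<open>Each interval lies in \<open>A\<close> or in \<open>B\<close>, and in both if it
    straddles \<open>m\<close>. Summands outside \<open>A\<close> or \<open>B\<close> are set to 0,
    so that both sums can run over \<open>S\<close>.\<close>
  have "variation_sum f S \<le> (\<Sum>p\<in>S. (if p \<in> A then norm (f (min (snd p) m) - f (fst p)) else 0)
      + (if p \<in> B then norm (f (snd p) - f (max (fst p) m)) else 0))"
    unfolding variation_sum_def
  proof (rule sum_mono, clarify)
    fix x y assume p: "(x, y) \<in> S"
    show "norm (f y - f x) \<le> (if (x, y) \<in> A then norm (f (min (snd (x, y)) m) - f (fst (x, y))) else 0)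
      + (if (x, y) \<in> B then norm (f (snd (x, y)) - f (max (fst (x, y)) m)) else 0)"
      using D[OF p] p norm_triangle_ineq[of "f m - f x" "f y - f m"]
      by (auto simp: A_def B_def min_def max_def)
  qed
  also have "\<dots> = variation_sum f (?l ` A) + variation_sum f (?r ` B)"
  proof -
    have "A \<subseteq> S" "B \<subseteq> S" by (auto simp: A_def B_def)
    then show ?thesis
      unfolding variation_sum_def sum.reindex[OF injl] sum.reindex[OF injr] sum.distrib
      by (simp add: sum.inter_restrict[symmetric] fin Int_absorb1 case_prod_beta o_def)
  qed
  finally have "ennreal (variation_sum f S) \<le> ennreal (variation_sum f (?l ` A)) + ennreal (variation_sum f (?r ` B))"
    by (simp add: ennreal_plus[symmetric] variation_sum_nonneg del: ennreal_plus)
  also have "\<dots> \<le> tot_var f s m + tot_var f m t"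
    by (intro add_mono variation_sum_le_tot_var l r)
  finally show "ennreal (variation_sum f S) \<le> tot_var f s m + tot_var f m t" .
qed

text \<open>The family \<open>S\<close> is refined inside one interval at a time; \<open>T\<close> collects the refined parts.\<close>

lemma sum_tot_var_le:
  assumes small: "\<And>S. nonoverlapping a b S \<Longrightarrow> total_length S < \<eta> \<Longrightarrow> variation_sum f S \<le> \<epsilon>"
    and "nonoverlapping a b S" "total_length S < \<eta>"
  shows "(\<Sum>(x, y)\<in>S. tot_var f x y) \<le> ennreal \<epsilon>"
proof -
  have "finite S" using assms(2) by (rule nonoverlapping_finite)
  then have "(\<Sum>(x, y)\<in>S. tot_var f x y) + ennreal (variation_sum f T) \<le> ennreal \<epsilon>"
    if "S \<inter> T = {}" "nonoverlapping a b (S \<union> T)" "total_length (S \<union> T) < \<eta>" for T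
    using that
  proof (induction S arbitrary: T)
    case empty
    then show ?case using small[of T] by (simp add: ennreal_leI)
  next
    case (insert p S)
    obtain x y where p: "p = (x, y)" by (cases p)
    note n = \<open>nonoverlapping a b (insert p S \<union> T)\<close>
    have xy: "x < y" using nonoverlappingD[OF n] p by blast
    have finT: "finite T" using nonoverlapping_finite[OF n] by simp
    \<comment> \<open>\<open>R\<close> is any family inside the interval \<open>p\<close>. The other
      terms do not depend on \<open>R\<close>, so a bound for all \<open>R\<close> passes to the
      supremum, which turns the first term into \<open>tot_var f x y\<close>.\<close>
    have "(SUP R\<in>Collect (nonoverlapping x y). ennreal (variation_sum f R) +
        ((\<Sum>(x, y)\<in>S. tot_var f x y) + ennreal (variation_sum f T))) \<le> ennreal \<epsilon>"
    proof (rule SUP_least)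
      fix R assume "R \<in> Collect (nonoverlapping x y)"
      then have R: "nonoverlapping x y R" by simp
      have sep: "R \<inter> (S \<union> T) = {}"
      proof -
        { fix x' y' assume h: "(x', y') \<in> R" "(x', y') \<in> S \<union> T"
          have "(x', y') \<noteq> (x, y)" using h insert.hyps insert.prems p by auto
          then have "y' \<le> x \<or> y \<le> x'"
            using nonoverlapping_disjD[OF n, of x' y' x y] h p by auto
          then have False using nonoverlappingD[OF R h(1)] by auto }
        then show ?thesis by auto
      qed
      have disj: "y' \<le> x'' \<or> y'' \<le> x'" if "(x', y') \<in> R" "(x'', y'') \<in> S \<union> T" for x' y' x'' y''
      proof -
        have "(x'', y'') \<noteq> (x, y)" using that insert.hyps insert.prems p by auto
        then have "y'' \<le> x \<or> y \<le> x''"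
          using nonoverlapping_disjD[OF n, of x'' y'' x y] that p by auto
        then show ?thesis using nonoverlappingD[OF R that(1)] by auto
      qed
      have "nonoverlapping a b (S \<union> (R \<union> T))"
      proof (rule nonoverlappingI)
        show "finite (S \<union> (R \<union> T))"
          using nonoverlapping_finite[OF R] insert.hyps finT by simp
      next
        fix x' y' assume "(x', y') \<in> S \<union> (R \<union> T)"
        then show "a \<le> x' \<and> x' < y' \<and> y' \<le> b"
          using nonoverlappingD[OF R, of x' y'] nonoverlappingD[OF n, of x' y'] nonoverlappingD[OF n, of x y] p
          by auto
      next
        fix x' y' x'' y'' assume "(x', y') \<in> S \<union> (R \<union> T)" "(x'', y'') \<in> S \<union> (R \<union> T)"
          "(x', y') \<noteq> (x'', y'')" "\<not> y'' \<le> x'"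
        then show "y' \<le> x''"
          using nonoverlapping_disjD[OF R, of x' y' x'' y''] nonoverlapping_disjD[OF n, of x' y' x'' y'']
            disj[of x' y' x'' y''] disj[of x'' y'' x' y'] by blast
      qed
      moreover have "total_length (S \<union> (R \<union> T)) < \<eta>"
      proof -
        have "total_length (S \<union> (R \<union> T)) = total_length R + total_length (S \<union> T)"
          unfolding total_length_def using sep nonoverlapping_finite[OF R] insert.hyps finT
          by (subst sum.union_disjoint[symmetric]) (auto simp: Un_ac)
        \<comment> \<open>Replacing \<open>p\<close> by intervals inside it cannot increase the
          total length, so the same \<open>\<eta>\<close> still applies.\<close>
        also have "\<dots> \<le> (y - x) + total_length (S \<union> T)"
          using total_length_le[OF R] xy by simp
        also have "\<dots> = total_length (insert p S \<union> T)"
          unfolding total_length_def using insert.hyps insert.prems finT p by simp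
        finally show ?thesis using insert.prems by simp
      qed
      ultimately have "(\<Sum>(x, y)\<in>S. tot_var f x y) + ennreal (variation_sum f (R \<union> T)) \<le> ennreal \<epsilon>"
        using insert.prems sep by (intro insert.IH) auto
      moreover have "variation_sum f (R \<union> T) = variation_sum f R + variation_sum f T"
        unfolding variation_sum_def using sep nonoverlapping_finite[OF R] finT
        by (intro sum.union_disjoint) auto
      ultimately show "ennreal (variation_sum f R) +
        ((\<Sum>(x, y)\<in>S. tot_var f x y) + ennreal (variation_sum f T)) \<le> ennreal \<epsilon>"
        by (simp add: ennreal_plus variation_sum_nonneg add_ac)
    qed
    then have "tot_var f x y + ((\<Sum>(x, y)\<in>S. tot_var f x y) + ennreal (variation_sum f T)) \<le> ennreal \<epsilon>"
      unfolding ennreal_SUP_add_left[OF nonoverlapping_nonempty] tot_var_def[symmetric] .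
    then show ?case using insert.hyps p by (simp add: add_ac)
  qed
  from this[of "{}"] show ?thesis using assms by (simp add: variation_sum_def)
qed

lemma small_variationE:
  assumes "small_variation a b f" "\<epsilon> > 0"
  obtains \<eta> where "\<eta> > 0"
    "\<And>S. nonoverlapping a b S \<Longrightarrow> total_length S < \<eta> \<Longrightarrow> variation_sum f S \<le> \<epsilon>"
  using assms unfolding small_variation_def by blast

lemma tot_var_trivial:
  assumes "t \<le> s"
  shows "tot_var f s t = 0"
proof -
  have "S = {}" if S: "nonoverlapping s t S" for S
    using nonoverlappingD[OF S] assms by force
  then have "tot_var f s t \<le> 0"
    unfolding tot_var_def by (intro SUP_least) (force simp: variation_sum_def)
  then show ?thesis by simp
qed

text \<open>The variation over any piece shorter than \<open>\<eta>\<close> is at most 1, and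
  finitely many such pieces make up \<open>{a..b}\<close>; subadditivity adds the bounds.\<close>

lemma tot_var_finite:
  assumes "small_variation a b f"
  shows "tot_var f a b < \<infinity>"
proof (cases "a \<le> b")
  case True
  obtain \<eta> where "\<eta> > 0" and
    \<eta>: "\<And>S. nonoverlapping a b S \<Longrightarrow> total_length S < \<eta> \<Longrightarrow> variation_sum f S \<le> 1"
    using small_variationE[OF assms, of 1] by auto
  have short: "tot_var f m t \<le> 1" if "a \<le> m" "m \<le> t" "t \<le> b" "t - m < \<eta>" for m t
    unfolding tot_var_def
  proof (rule SUP_least)
    fix S assume "S \<in> Collect (nonoverlapping m t)"
    then have S: "nonoverlapping m t S" by simp
    have "variation_sum f S \<le> 1"
      using nonoverlapping_mono[OF S] total_length_le[OF S] that by (intro \<eta>) auto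
    then show "ennreal (variation_sum f S) \<le> 1"
      using ennreal_leI by fastforce
  qed
  have "tot_var f a t \<le> of_nat n" if "a \<le> t" "t \<le> b" "t \<le> a + real n * (\<eta> / 2)" for n t
    using that
  proof (induction n arbitrary: t)
    case 0
    then have "t = a" by simp
    then show ?case by (simp add: tot_var_trivial)
  next
    case (Suc n)
    \<comment> \<open>Going back by \<open>\<eta> / 2\<close> keeps the last piece strictly shorter
      than \<open>\<eta>\<close>; the maximum stops the walk at \<open>a\<close>.\<close>
    define m where "m = max a (t - \<eta> / 2)"
    have "real (Suc n) * (\<eta> / 2) = real n * (\<eta> / 2) + \<eta> / 2" "0 \<le> real n * (\<eta> / 2)"
      using \<open>\<eta> > 0\<close> by (simp_all add: field_simps)
    then have m: "a \<le> m" "m \<le> t" "t - m < \<eta>" "m \<le> a + real n * (\<eta> / 2)"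
      using Suc.prems \<open>\<eta> > 0\<close> unfolding m_def by linarith+
    have "tot_var f a t \<le> tot_var f a m + tot_var f m t"
      using m by (intro tot_var_le_add)
    also have "\<dots> \<le> of_nat n + 1"
      using m Suc.prems by (intro add_mono Suc.IH short) auto
    finally show ?case by (simp add: add.commute)
  qed
  moreover obtain n where "(b - a) / (\<eta> / 2) \<le> real n"
    using real_arch_simple by blast
  ultimately have "tot_var f a b \<le> of_nat n"
    using True \<open>\<eta> > 0\<close> by (simp add: field_simps)
  then show ?thesis
    using le_less_trans[OF _ of_nat_less_top] by (simp add: infinity_ennreal_def)
next
  case False
  then show ?thesis by (simp add: tot_var_trivial)
qed

text \<open>Used for the extension of a function by constants and for the coordinates of a
  vector-valued function, whose increments are dominated by those of the original.\<close>

lemma small_variation_le: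
  assumes "small_variation a b f"
    and "\<And>x y. a \<le> x \<Longrightarrow> x \<le> y \<Longrightarrow> y \<le> b \<Longrightarrow> norm (g y - g x) \<le> norm (f y - f x)"
  shows "small_variation a b g"
  unfolding small_variation_def
proof (intro allI impI)
  fix \<epsilon> :: real assume "\<epsilon> > 0"
  then obtain \<eta> where \<eta>: "\<eta> > 0"
    "\<And>S. nonoverlapping a b S \<Longrightarrow> total_length S < \<eta> \<Longrightarrow> variation_sum f S \<le> \<epsilon>"
    using small_variationE[OF assms(1)] by metis
  have "variation_sum g S \<le> variation_sum f S" if "nonoverlapping a b S" for S
    unfolding variation_sum_def using nonoverlappingD[OF that]
    by (intro sum_mono) (auto intro!: assms(2) simp: less_imp_le)
  then show "\<exists>\<eta>>0. \<forall>S. nonoverlapping a b S \<and> total_length S < \<eta> \<longrightarrow> variation_sum g S \<le> \<epsilon>"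
    using \<eta> by (meson order_trans)
qed

lemma small_variation_diff:
  assumes "small_variation a b f" "small_variation a b g"
  shows "small_variation a b (\<lambda>x. f x - g x)"
  unfolding small_variation_def
proof (intro allI impI)
  fix \<epsilon> :: real assume "\<epsilon> > 0"
  then have "\<epsilon> / 2 > 0" by simp
  obtain \<eta> where \<eta>: "\<eta> > 0"
    "\<And>S. nonoverlapping a b S \<Longrightarrow> total_length S < \<eta> \<Longrightarrow> variation_sum f S \<le> \<epsilon> / 2"
    using small_variationE[OF assms(1) \<open>\<epsilon> / 2 > 0\<close>] by metis
  obtain \<eta>' where \<eta>': "\<eta>' > 0"
    "\<And>S. nonoverlapping a b S \<Longrightarrow> total_length S < \<eta>' \<Longrightarrow> variation_sum g S \<le> \<epsilon> / 2"
    using small_variationE[OF assms(2) \<open>\<epsilon> / 2 > 0\<close>] by metis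
  have le: "variation_sum (\<lambda>x. f x - g x) S \<le> variation_sum f S + variation_sum g S" for S
    unfolding variation_sum_def sum.distrib[symmetric]
  proof (rule sum_mono)
    fix p :: "real \<times> real"
    show "(case p of (x, y) \<Rightarrow> norm (f y - g y - (f x - g x)))
        \<le> (case p of (x, y) \<Rightarrow> norm (f y - f x)) + (case p of (x, y) \<Rightarrow> norm (g y - g x))"
      using norm_triangle_ineq4[of "f (snd p) - f (fst p)" "g (snd p) - g (fst p)"]
      by (simp add: case_prod_beta algebra_simps)
  qed
  have "variation_sum (\<lambda>x. f x - g x) S \<le> \<epsilon>"
    if "nonoverlapping a b S" "total_length S < min \<eta> \<eta>'" for S
    using le[of S] \<eta>(2)[of S] \<eta>'(2)[of S] that by auto
  then show "\<exists>\<eta>>0. \<forall>S. nonoverlapping a b S \<and> total_length S < \<eta> \<longrightarrow> variation_sum (\<lambda>x. f x - g x) S \<le> \<epsilon>"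
    using \<eta>(1) \<eta>'(1) by (intro exI[of _ "min \<eta> \<eta>'"]) auto
qed

lemma small_variation_continuous_on:
  assumes "small_variation a b f"
  shows "continuous_on {a..b} f"
proof (clarsimp simp: continuous_on_iff)
  fix x \<epsilon> :: real assume x: "a \<le> x" "x \<le> b" and "\<epsilon> > 0"
  \<comment> \<open>\<open>small_variation\<close> gives a non-strict bound where continuity asks
    for a strict one, hence the half. Families of a single interval suffice.\<close>
  then have "\<epsilon> / 2 > 0" by simp
  then obtain \<eta> where \<eta>: "\<eta> > 0"
    "\<And>S. nonoverlapping a b S \<Longrightarrow> total_length S < \<eta> \<Longrightarrow> variation_sum f S \<le> \<epsilon> / 2"
    using small_variationE[OF assms] by metis
  have one: "norm (f z - f y) \<le> \<epsilon> / 2" if "a \<le> y" "y < z" "z \<le> b" "z - y < \<eta>" for y z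
    using \<eta>(2)[of "{(y, z)}"] that
    by (simp add: nonoverlapping_def total_length_def variation_sum_def)
  have "dist (f x') (f x) < \<epsilon>" if "a \<le> x'" "x' \<le> b" "dist x' x < \<eta>" for x'
    using one[of x x'] one[of x' x] that x \<open>\<epsilon> > 0\<close>
    by (cases x x' rule: linorder_cases) (auto simp: dist_norm norm_minus_commute dist_real_def)
  then show "\<exists>d>0. \<forall>x'\<in>{a..b}. dist x' x < d \<longrightarrow> dist (f x') (f x) < \<epsilon>"
    using \<eta>(1) by auto
qed

section \<open>Absolutely continuous functions as indefinite integrals\<close>

text \<open>A null set sits in an open set of length below \<open>\<eta>\<close>. The covering lemma
  covers its part in \<open>{a..b}\<close> by countably many nonoverlapping compact intervals inside
  the open set, and the Stieltjes measure of finitely many of them is at most a variation sum, hence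
  at most \<open>\<epsilon>\<close>.\<close>

lemma interval_measure_absolutely_continuous:
  fixes F :: "real \<Rightarrow> real"
  assumes "a < b" "small_variation a b F"
    and mono: "\<And>x y. x \<le> y \<Longrightarrow> F x \<le> F y" and cont: "continuous_on UNIV F"
    and N: "N \<in> null_sets lborel"
  shows "emeasure (interval_measure F) (N \<inter> {a..b}) = 0"
proof -
  have bound: "emeasure (interval_measure F) (N \<inter> {a..b}) \<le> 0 + ennreal \<epsilon>" if "\<epsilon> > 0" for \<epsilon>
  proof -
    obtain \<eta> where \<eta>: "\<eta> > 0"
      "\<And>S. nonoverlapping a b S \<Longrightarrow> total_length S < \<eta> \<Longrightarrow> variation_sum F S \<le> \<epsilon>"
      using small_variationE[OF assms(2) \<open>\<epsilon> > 0\<close>] by metis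
    obtain U where U: "open U" "N \<subseteq> U" "emeasure lborel (U - N) < ennreal \<eta>"
      using outer_regular_lborel[of N \<eta>] null_setsD2[OF N] \<eta>(1) by auto
    have "emeasure lborel U = emeasure lborel (N \<union> (U - N))"
      using U by (intro arg_cong[of _ _ "emeasure lborel"]) auto
    also have "\<dots> = emeasure lborel (U - N)"
      using N U(1) by (subst Un_commute, intro emeasure_Un_null_set) auto
    finally have U': "emeasure lborel U < ennreal \<eta>" using U by simp
    \<comment> \<open>The value \<open>UNIV\<close> off \<open>U\<close> is irrelevant: the tags lie in \<open>N \<subseteq> U\<close>, so all intervals of the cover lie in \<open>U\<close>.\<close>
    have gauge: "gauge (\<lambda>x. if x \<in> U then U else UNIV)"
      using U(1) by (auto simp: gauge_def)
    obtain \<D> where \<D>: "countable \<D>" "\<Union>\<D> \<subseteq> cbox a b"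
      "\<And>K. K \<in> \<D> \<Longrightarrow> interior K \<noteq> {} \<and> (\<exists>c d. K = cbox c d)"
      "pairwise (\<lambda>A B. interior A \<inter> interior B = {}) \<D>"
      "\<And>K. K \<in> \<D> \<Longrightarrow> \<exists>x\<in>(N \<inter> {a..b}) \<inter> K. K \<subseteq> (if x \<in> U then U else UNIV)"
      "N \<inter> {a..b} \<subseteq> \<Union>\<D>"
      by (rule covering_lemma[of "N \<inter> {a..b}" a b, OF _ _ gauge]) (use \<open>a < b\<close> in auto)
    have DU: "K \<subseteq> U" if K: "K \<in> \<D>" for K
    proof -
      obtain x where "x \<in> N" "K \<subseteq> (if x \<in> U then U else UNIV)"
        using \<D>(5)[OF K] by blast
      then show ?thesis using U(2) by (auto split: if_splits)
    qed
    have Dint: "\<exists>c d. c < d \<and> a \<le> c \<and> d \<le> b \<and> K = {c..d}" if K: "K \<in> \<D>" for K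
    proof -
      obtain c d where cd: "K = {c..d}" using \<D>(3)[OF K] by auto
      moreover have "c < d" using \<D>(3)[OF K] cd by (simp add: interior_atLeastAtMost_real)
      moreover have "c \<in> {a..b}" "d \<in> {a..b}"
        using \<D>(2) K cd \<open>c < d\<close> by fastforce+
      ultimately show ?thesis by auto
    qed
    have fin: "emeasure (interval_measure F) (\<Union>E) \<le> ennreal \<epsilon>" if E: "finite E" "E \<subseteq> \<D>" for E
    proof -
      \<comment> \<open>Each cell is a nondegenerate compact interval, so it is recovered from its
        infimum and supremum; a finite subfamily thus becomes a family of endpoint pairs.\<close>
      define S where "S = (\<lambda>K. (Inf K, Sup K)) ` E"
      have IE0: "K = {Inf K..Sup K} \<and> Inf K < Sup K \<and> a \<le> Inf K \<and> Sup K \<le> b" if "K \<in> E" for K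
      proof -
        obtain c d where "c < d" "a \<le> c" "d \<le> b" "K = {c..d}"
          using Dint[of K] \<open>K \<in> E\<close> E by blast
        then show ?thesis by simp
      qed
      note KE = IE0[THEN conjunct1] and IE = IE0[THEN conjunct2]
      have disjE: "{Inf K<..<Sup K} \<inter> {Inf K'<..<Sup K'} = {}" if "K \<in> E" "K' \<in> E" "K \<noteq> K'" for K K'
      proof -
        have "interior K \<inter> interior K' = {}"
          using \<D>(4) E that unfolding pairwise_def by blast
        moreover have "interior K = {Inf K<..<Sup K}" "interior K' = {Inf K'<..<Sup K'}"
          using KE[OF that(1)] KE[OF that(2)] interior_atLeastAtMost_real by metis+
        ultimately show ?thesis by simp
      qed
      have inj: "inj_on (\<lambda>K. (Inf K, Sup K)) E"
        by (intro inj_onI) (metis KE prod.inject)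
      have S: "nonoverlapping a b S"
      proof (rule nonoverlappingI)
        show "finite S" using E by (simp add: S_def)
        show "a \<le> x \<and> x < y \<and> y \<le> b" if "(x, y) \<in> S" for x y
          using that IE by (auto simp: S_def)
        fix x y x' y' assume h: "(x, y) \<in> S" "(x', y') \<in> S" "(x, y) \<noteq> (x', y')" "\<not> y' \<le> x"
        then obtain K K' where K: "K \<in> E" "K' \<in> E" "x = Inf K" "y = Sup K" "x' = Inf K'" "y' = Sup K'"
          by (auto simp: S_def)
        then have "K \<noteq> K'" using h(3) by auto
        then have "{x<..<y} \<inter> {x'<..<y'} = {}" "x < y" "x' < y'"
          using disjE[OF K(1,2)] IE[OF K(1)] IE[OF K(2)] K by auto
        then show "y \<le> x'"
          using h(4) by (auto simp: min_def max_def not_le split: if_splits)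
      qed
      have "ennreal (total_length S) = (\<Sum>K\<in>E. ennreal (Sup K - Inf K))"
        unfolding total_length_def S_def sum.reindex[OF inj]
        using IE by (subst sum_ennreal) (auto simp: less_imp_le)
      also have "\<dots> = (\<Sum>K\<in>E. emeasure lborel {Inf K<..<Sup K})"
        using IE by (intro sum.cong) (auto simp: less_imp_le)
      also have "\<dots> = emeasure lborel (\<Union>K\<in>E. {Inf K<..<Sup K})"
        using E(1) disjE by (intro sum_emeasure) (auto simp: disjoint_family_on_def)
      also have "\<dots> \<le> emeasure lborel U"
      proof (rule emeasure_mono)
        show "(\<Union>K\<in>E. {Inf K<..<Sup K}) \<subseteq> U"
        proof
          fix z assume "z \<in> (\<Union>K\<in>E. {Inf K<..<Sup K})"
          then obtain K where "K \<in> E" "z \<in> {Inf K..Sup K}" by force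
          then show "z \<in> U" using KE[of K] DU[of K] E by blast
        qed
      qed (use U(1) in auto)
      also have "\<dots> < ennreal \<eta>" by (rule U')
      finally have "total_length S < \<eta>"
        by (simp add: ennreal_less_iff total_length_def sum_nonneg nonoverlappingD[OF S] less_imp_le case_prod_beta)
      then have "variation_sum F S \<le> \<epsilon>" using \<eta>(2) S by blast
      \<comment> \<open>Neighbouring cells may share endpoints, and subadditivity avoids treating
        them separately. Continuity of \<open>F\<close> makes the mass of a closed cell equal to the
        increment of \<open>F\<close>.\<close>
      have "emeasure (interval_measure F) (\<Union>K\<in>E. K) \<le> (\<Sum>K\<in>E. emeasure (interval_measure F) K)"
      proof (rule emeasure_subadditive_finite[OF E(1)], rule image_subsetI)
        fix K assume "K \<in> E"
        then show "K \<in> sets (interval_measure F)"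
          using KE[of K] atLeastAtMost_borel[of "Inf K" "Sup K"] by simp
      qed
      also have "\<dots> = (\<Sum>K\<in>E. ennreal (norm (F (Sup K) - F (Inf K))))"
      proof (rule sum.cong[OF refl])
        fix K assume "K \<in> E"
        then show "emeasure (interval_measure F) K = ennreal (norm (F (Sup K) - F (Inf K)))"
          using IE[of K] emeasure_interval_measure_Icc[OF _ mono cont, of "Inf K" "Sup K"] mono[of "Inf K" "Sup K"]
            KE[of K, symmetric] by (simp add: less_imp_le)
      qed
      also have "\<dots> = ennreal (variation_sum F S)"
        unfolding variation_sum_def S_def sum.reindex[OF inj] by (subst sum_ennreal) auto
      also have "\<dots> \<le> ennreal \<epsilon>"
        using \<open>variation_sum F S \<le> \<epsilon>\<close> by (rule ennreal_leI)
      finally show ?thesis by simp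
    qed
    have meas: "K \<in> sets borel" if "K \<in> \<D>" for K
      using Dint[OF that] by auto
    \<comment> \<open>The countable union is the increasing limit of finite unions, so continuity
      from below carries the uniform bound over. The enumeration \<open>from_nat_into\<close> is
      onto only for a nonempty family.\<close>
    have "emeasure (interval_measure F) (\<Union>\<D>) \<le> ennreal \<epsilon>"
    proof (cases "\<D> = {}")
      case False
      define K where "K = from_nat_into \<D>"
      have K: "range K = \<D>"
        unfolding K_def using \<D>(1) False by (simp add: range_from_nat_into)
      then have KD: "K i \<in> \<D>" for i by auto
      have "emeasure (interval_measure F) (\<Union>\<D>) = emeasure (interval_measure F) (\<Union>n. \<Union>i<n. K i)"
        unfolding K[symmetric] by (intro arg_cong[of _ _ "emeasure _"]) blast
      also have "\<dots> = (SUP n. emeasure (interval_measure F) (\<Union>i<n. K i))"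
        using meas[OF KD]
        by (intro SUP_emeasure_incseq[symmetric] monoI UN_mono image_subsetI sets.finite_UN) auto
      also have "\<dots> \<le> ennreal \<epsilon>"
        using KD by (intro SUP_least fin) auto
      finally show ?thesis .
    qed simp
    moreover have "\<Union>\<D> \<in> sets (interval_measure F)"
      using meas \<D>(1) by (intro sets.countable_Union) auto
    ultimately show ?thesis
      using emeasure_mono[OF \<D>(6), of "interval_measure F"] by simp
  qed
  have "emeasure (interval_measure F) (N \<inter> {a..b}) \<le> 0"
    by (rule ennreal_le_epsilon) (rule bound)
  then show ?thesis by simp
qed

text \<open>The Stieltjes measure gives \<open>{a..t}\<close> the increment of \<open>F\<close> as
  its mass and charges no null set by the preceding lemma; \<open>g\<close> is its Radon-Nikodym
  derivative, made real-valued.\<close>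

lemma monotone_small_variation_density:
  fixes F :: "real \<Rightarrow> real"
  assumes "a < b" "small_variation a b F"
    and mono: "\<And>x y. a \<le> x \<Longrightarrow> x \<le> y \<Longrightarrow> y \<le> b \<Longrightarrow> F x \<le> F y"
  obtains g :: "real \<Rightarrow> real" where "integrable lborel g"
    "\<And>t. a \<le> t \<Longrightarrow> t \<le> b \<Longrightarrow> F t - F a = (LINT s:{a..t}|lborel. g s)"
proof -
  \<comment> \<open>Extending \<open>F\<close> by its end values keeps it monotone and continuous on
    the whole line, as \<open>interval_measure\<close> requires.\<close>
  define H where "H x = F (max a (min b x))" for x
  have monoH: "H x \<le> H y" if "x \<le> y" for x y
    unfolding H_def using that \<open>a < b\<close> by (intro mono) auto
  have contH: "continuous_on UNIV H"
    unfolding H_def using \<open>a < b\<close>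
    by (intro continuous_on_compose2[OF small_variation_continuous_on[OF assms(2)]] continuous_intros) auto
  have smallH: "small_variation a b H"
    by (rule small_variation_le[OF assms(2)]) (auto simp: H_def)
  define \<nu> where "\<nu> = interval_measure H"
  have \<nu>Icc: "emeasure \<nu> {s..t} = ennreal (H t - H s)" if "s \<le> t" for s t
    unfolding \<nu>_def using that monoH contH by (rule emeasure_interval_measure_Icc)
  have [measurable_cong, simp]: "sets \<nu> = sets borel" by (simp add: \<nu>_def)
  \<comment> \<open>Restricting to \<open>{a..b}\<close> matches the absolute continuity result,
    which speaks of \<open>N \<inter> {a..b}\<close>.\<close>
  define \<mu> where "\<mu> = density \<nu> (indicator {a..b})"
  have \<mu>: "emeasure \<mu> A = emeasure \<nu> (A \<inter> {a..b})" if "A \<in> sets borel" for A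
  proof -
    have "emeasure \<mu> A = (\<integral>\<^sup>+x. indicator {a..b} x * indicator A x \<partial>\<nu>)"
      unfolding \<mu>_def using that by (intro emeasure_density) auto
    also have "\<dots> = (\<integral>\<^sup>+x. indicator (A \<inter> {a..b}) x \<partial>\<nu>)"
      by (intro nn_integral_cong) (auto simp: indicator_def)
    finally show ?thesis using that by simp
  qed
  have "absolutely_continuous lborel \<mu>"
    unfolding absolutely_continuous_def
  proof
    fix N assume N: "N \<in> null_sets (lborel :: real measure)"
    then show "N \<in> null_sets \<mu>"
      using interval_measure_absolutely_continuous[OF \<open>a < b\<close> smallH monoH contH N] \<mu>[of N]
      by (auto simp: null_sets_def \<mu>_def \<nu>_def)
  qed
  moreover have "sets \<mu> = sets lborel" by (simp add: \<mu>_def)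
  ultimately obtain h where h: "h \<in> borel_measurable lborel" "density lborel h = \<mu>"
    using sigma_finite_measure.Radon_Nikodym[OF sigma_finite_lborel] by blast
  have [measurable]: "h \<in> borel_measurable borel" using h(1) by simp
  have hI: "(\<integral>\<^sup>+x\<in>{a..t}. h x \<partial>lborel) = ennreal (F t - F a)" if "a \<le> t" "t \<le> b" for t
  proof -
    have "(\<integral>\<^sup>+x\<in>{a..t}. h x \<partial>lborel) = emeasure \<mu> {a..t}"
      unfolding h(2)[symmetric] by (simp add: emeasure_density)
    also have "\<dots> = emeasure \<nu> {a..t}"
      using that by (subst \<mu>) (auto intro!: arg_cong[of _ _ "emeasure \<nu>"])
    finally show ?thesis using that by (simp add: \<nu>Icc H_def min_def max_def)
  qed
  have fin: "(\<integral>\<^sup>+x. h x * indicator {a..b} x \<partial>lborel) \<noteq> \<infinity>"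
    using hI[of b] \<open>a < b\<close> by simp
  have "AE x in lborel. h x * indicator {a..b} x \<noteq> \<infinity>"
    by (intro nn_integral_PInf_AE fin) auto
  then have AE: "AE x in lborel. ennreal (enn2real (h x)) * indicator {a..b} x = h x * indicator {a..b} x"
    by eventually_elim (auto simp: indicator_def less_top)
  \<comment> \<open>The integral of \<open>h\<close> over \<open>{a..b}\<close> is finite, so
    \<open>h\<close> is finite almost everywhere there and \<open>enn2real\<close> alters it there
    only on a null set.\<close>
  define g where "g x = enn2real (h x) * indicator {a..b} x" for x
  have gt: "(\<integral>\<^sup>+x. ennreal (g x * indicator {a..t} x) \<partial>lborel) = ennreal (F t - F a)" if "a \<le> t" "t \<le> b" for t
  proof -
    have "(\<integral>\<^sup>+x. ennreal (g x * indicator {a..t} x) \<partial>lborel) = (\<integral>\<^sup>+x\<in>{a..t}. h x \<partial>lborel)"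
      by (rule nn_integral_cong_AE, use AE in eventually_elim)
         (use that in \<open>auto simp: g_def indicator_def split: if_splits\<close>)
    with hI[OF that] show ?thesis by simp
  qed
  have "g \<in> borel_measurable borel" unfolding g_def by measurable
  show ?thesis
  proof (rule that[of g])
    have *: "g x * indicator {a..b} x = g x" for x by (simp add: g_def indicator_def)
    show "integrable lborel g"
      using gt[of b, unfolded *] \<open>a < b\<close> \<open>g \<in> borel_measurable borel\<close>
      by (intro integrableI_nonneg) (auto simp: g_def)
    show "F t - F a = (LINT s:{a..t}|lborel. g s)" if t: "a \<le> t" "t \<le> b" for t
      unfolding set_lebesgue_integral_def
      using gt[OF t] \<open>g \<in> borel_measurable borel\<close> mono[of a t] t
      by (subst integral_eq_nn_integral) (auto simp: g_def mult.commute)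
  qed
qed

text \<open>Increments of \<open>f\<close> are dominated by those of \<open>V\<close>, so
  \<open>V\<close> and \<open>V - f\<close> are both nondecreasing; the density of \<open>f\<close>
  is the difference of theirs.\<close>

lemma real_small_variation_density:
  fixes f :: "real \<Rightarrow> real"
  assumes "a < b" "small_variation a b f"
  obtains g :: "real \<Rightarrow> real" where "integrable lborel g"
    "\<And>t. a \<le> t \<Longrightarrow> t \<le> b \<Longrightarrow> f t - f a = (LINT s:{a..t}|lborel. g s)"
proof -
  define V where "V t = enn2real (tot_var f a t)" for t
  have small_le: "small_variation s t f" if "a \<le> s" "t \<le> b" for s t
    using assms(2) that unfolding small_variation_def by (meson nonoverlapping_mono)
  have fin: "tot_var f s t < top" if "a \<le> s" "t \<le> b" for s t
    using tot_var_finite[OF small_le[OF that]] by simp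
  have V: "\<bar>f y - f x\<bar> \<le> V y - V x" "V y - V x \<le> enn2real (tot_var f x y)"
    if "a \<le> x" "x \<le> y" "y \<le> b" for x y
  proof -
    have "ennreal (V x + norm (f y - f x)) \<le> ennreal (V y)"
      using tot_var_add_le[of a x y f] that fin[of a x] fin[of a y] by (simp add: V_def)
    then show "\<bar>f y - f x\<bar> \<le> V y - V x"
      by (simp add: V_def flip: ennreal_plus)
    have "ennreal (V y) \<le> ennreal (V x + enn2real (tot_var f x y))"
      using tot_var_le_add[of a x y f] that fin[of a x] fin[of a y] fin[of x y] by (simp add: V_def)
    then show "V y - V x \<le> enn2real (tot_var f x y)"
      by (simp add: V_def flip: ennreal_plus)
  qed
  \<comment> \<open>The \<open>\<eta>\<close> of \<open>f\<close> serves for \<open>V\<close> too: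
    the increment of \<open>V\<close> over an interval is at most the variation of \<open>f\<close>
    there, and \<open>sum_tot_var_le\<close> bounds the sum of these variations.\<close>
  have smallV: "small_variation a b V"
    unfolding small_variation_def
  proof (intro allI impI)
    fix \<epsilon> :: real assume "\<epsilon> > 0"
    obtain \<eta> where \<eta>: "\<eta> > 0"
      "\<And>S. nonoverlapping a b S \<Longrightarrow> total_length S < \<eta> \<Longrightarrow> variation_sum f S \<le> \<epsilon>"
      using small_variationE[OF assms(2) \<open>\<epsilon> > 0\<close>] by metis
    have "variation_sum V S \<le> \<epsilon>" if S: "nonoverlapping a b S" "total_length S < \<eta>" for S
    proof -
      have "ennreal (variation_sum V S) = (\<Sum>(x, y)\<in>S. ennreal (norm (V y - V x)))"
        unfolding variation_sum_def by (subst sum_ennreal[symmetric]) (auto simp: case_prod_beta)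
      also have "\<dots> \<le> (\<Sum>(x, y)\<in>S. tot_var f x y)"
      proof (rule sum_mono)
        fix p assume "p \<in> S"
        moreover obtain x y where p: "p = (x, y)" by (cases p)
        ultimately have xy: "a \<le> x" "x \<le> y" "y \<le> b" using nonoverlappingD[OF S(1)] by force+
        have "norm (V y - V x) \<le> enn2real (tot_var f x y)"
          using V[OF xy] by (simp add: V_def)
        then have "ennreal (norm (V y - V x)) \<le> ennreal (enn2real (tot_var f x y))"
          by (rule ennreal_leI)
        then show "(case p of (x, y) \<Rightarrow> ennreal (norm (V y - V x))) \<le> (case p of (x, y) \<Rightarrow> tot_var f x y)"
          using fin xy p by simp
      qed
      also have "\<dots> \<le> ennreal \<epsilon>"
        by (rule sum_tot_var_le[OF \<eta>(2) S])
      finally show ?thesis using \<open>\<epsilon> > 0\<close> by simp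
    qed
    then show "\<exists>\<eta>>0. \<forall>S. nonoverlapping a b S \<and> total_length S < \<eta> \<longrightarrow> variation_sum V S \<le> \<epsilon>"
      using \<eta>(1) by blast
  qed
  obtain g1 where g1: "integrable lborel g1"
    "\<And>t. a \<le> t \<Longrightarrow> t \<le> b \<Longrightarrow> V t - V a = (LINT s:{a..t}|lborel. g1 s)"
    using monotone_small_variation_density[OF \<open>a < b\<close> smallV] V by (smt (verit))
  obtain g2 where g2: "integrable lborel g2"
    "\<And>t. a \<le> t \<Longrightarrow> t \<le> b \<Longrightarrow> (V t - f t) - (V a - f a) = (LINT s:{a..t}|lborel. g2 s)"
  proof (rule monotone_small_variation_density[OF \<open>a < b\<close> small_variation_diff[OF smallV assms(2)]])
    show "V x - f x \<le> V y - f y" if "a \<le> x" "x \<le> y" "y \<le> b" for x y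
      using V(1)[OF that] by linarith
  qed blast
  show ?thesis
  proof (rule that[of "\<lambda>s. g1 s - g2 s"])
    show "integrable lborel (\<lambda>s. g1 s - g2 s)" using g1 g2 by simp
    fix t assume t: "a \<le> t" "t \<le> b"
    have "set_integrable lborel {a..t} g1" "set_integrable lborel {a..t} g2"
      unfolding set_integrable_def
      by (rule integrable_mult_indicator[OF _ g1(1)], simp)
         (rule integrable_mult_indicator[OF _ g2(1)], simp)
    then show "f t - f a = (LINT s:{a..t}|lborel. g1 s - g2 s)"
      using g1(2)[OF t] g2(2)[OF t] by (simp add: set_integral_diff)
  qed
qed

text \<open>Coordinatewise: each \<open>f t \<bullet> i\<close> has a real density, and these
  recombine along the basis.\<close>

lemma absolutely_continuous_density:
  fixes f :: "real \<Rightarrow> 'a::euclidean_space"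
  assumes "a < b" "absolutely_continuous_on a b f"
  obtains g :: "real \<Rightarrow> 'a" where "integrable lborel g"
    "\<And>t. a \<le> t \<Longrightarrow> t \<le> b \<Longrightarrow> f t - f a = (LINT s:{a..t}|lborel. g s)"
proof -
  have "\<exists>g :: real \<Rightarrow> real. integrable lborel g \<and>
      (\<forall>t. a \<le> t \<longrightarrow> t \<le> b \<longrightarrow> f t \<bullet> i - f a \<bullet> i = (LINT s:{a..t}|lborel. g s))" if "i \<in> Basis" for i
  proof -
    have "small_variation a b (\<lambda>t. f t \<bullet> i)"
      using absolutely_continuous_on_small_variation[OF assms(2)]
    proof (rule small_variation_le)
      show "norm (f y \<bullet> i - f x \<bullet> i) \<le> norm (f y - f x)" for x y
        using Basis_le_norm[OF that, of "f y - f x"] by (simp add: inner_diff_left)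
    qed
    from real_small_variation_density[OF assms(1) this] show ?thesis by metis
  qed
  then obtain G where G: "\<And>i. i \<in> Basis \<Longrightarrow> integrable lborel (G i)"
    "\<And>i t. i \<in> Basis \<Longrightarrow> a \<le> t \<Longrightarrow> t \<le> b \<Longrightarrow> f t \<bullet> i - f a \<bullet> i = (LINT s:{a..t}|lborel. G i s :: real)"
    by metis
  show ?thesis
  proof (rule that[of "\<lambda>s. \<Sum>i\<in>Basis. G i s *\<^sub>R i"])
    show "integrable lborel (\<lambda>s. \<Sum>i\<in>Basis. G i s *\<^sub>R i)"
      using G(1) by auto
    fix t assume t: "a \<le> t" "t \<le> b"
    have int: "integrable lborel (\<lambda>s. indicator {a..t} s * G i s)" if "i \<in> Basis" for i
      using integrable_mult_indicator[of "{a..t}" lborel "G i"] G(1)[OF that] by simp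
    have "(LINT s:{a..t}|lborel. (\<Sum>i\<in>Basis. G i s *\<^sub>R i)) =
        (LINT s|lborel. (\<Sum>i\<in>Basis. (indicator {a..t} s * G i s) *\<^sub>R i))"
      unfolding set_lebesgue_integral_def by (simp add: scaleR_sum_right)
    also have "\<dots> = (\<Sum>i\<in>Basis. (LINT s|lborel. indicator {a..t} s * G i s) *\<^sub>R i)"
      using int by (subst Bochner_Integration.integral_sum) auto
    also have "\<dots> = (\<Sum>i\<in>Basis. ((f t - f a) \<bullet> i) *\<^sub>R i)"
      using G(2)[OF _ t] by (intro sum.cong) (auto simp: set_lebesgue_integral_def inner_diff_left)
    finally show "f t - f a = (LINT s:{a..t}|lborel. (\<Sum>i\<in>Basis. G i s *\<^sub>R i))"
      by (simp add: euclidean_representation)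
  qed
qed

section \<open>Lebesgue differentiation on the line\<close>

text \<open>Restates convergence of the averages over \<open>{x..x + h}\<close> as an error bound
  linear in \<open>h\<close>, the form that \<open>has_derivative_at_alt\<close> asks for.\<close>

lemma right_average_tendsto_AE:
  fixes f :: "real \<Rightarrow> 'a::euclidean_space"
  assumes "\<And>a b. f integrable_on {a..b}"
  obtains N where "negligible N"
    "\<And>x e. x \<notin> N \<Longrightarrow> 0 < e \<Longrightarrow>
       \<exists>d>0. \<forall>h. 0 < h \<and> h < d \<longrightarrow> norm (integral {x..x + h} f - h *\<^sub>R f x) \<le> e * h"
proof -
  obtain N where N: "negligible N"
    "\<And>x e. x \<notin> N \<Longrightarrow> 0 < e \<Longrightarrow>
       \<exists>d>0. \<forall>h. 0 < h \<and> h < d \<longrightarrow> norm (integral {x..x + h} f /\<^sub>R h - f x) < e"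
    using integrable_ccontinuous_explicit[of f] assms by auto
  show ?thesis
  proof (rule that[OF N(1)])
    fix x e :: real assume "x \<notin> N" "0 < e"
    then obtain d where d: "d > 0" "\<And>h. 0 < h \<Longrightarrow> h < d \<Longrightarrow> norm (integral {x..x + h} f /\<^sub>R h - f x) < e"
      using N(2) by metis
    have "norm (integral {x..x + h} f - h *\<^sub>R f x) \<le> e * h" if "0 < h" "h < d" for h
    proof -
      have "integral {x..x + h} f - h *\<^sub>R f x = h *\<^sub>R (integral {x..x + h} f /\<^sub>R h - f x)"
        using that by (simp add: scaleR_diff_right)
      also have "norm \<dots> \<le> h * e"
        using d(2)[OF that] that by (simp add: less_imp_le)
      finally show ?thesis by (simp add: mult.commute)
    qed
    with d(1) show "\<exists>d>0. \<forall>h. 0 < h \<and> h < d \<longrightarrow> norm (integral {x..x + h} f - h *\<^sub>R f x) \<le> e * h"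
      by blast
  qed
qed

text \<open>Almost everywhere both one-sided averages converge to \<open>f x\<close>. The
  exceptional set comes from \<open>f\<close> alone, so one set serves for every base point
  \<open>a\<close>.\<close>

theorem indefinite_integral_has_vector_derivative_AE:
  fixes f :: "real \<Rightarrow> 'a::euclidean_space"
  assumes int: "\<And>a b. f integrable_on {a..b}"
  obtains N where "negligible N"
    "\<And>a x. x \<notin> N \<Longrightarrow> a < x \<Longrightarrow> ((\<lambda>t. integral {a..t} f) has_vector_derivative f x) (at x)"
proof -
  obtain N where N: "negligible N"
    "\<And>x e. x \<notin> N \<Longrightarrow> 0 < e \<Longrightarrow>
       \<exists>d>0. \<forall>h. 0 < h \<and> h < d \<longrightarrow> norm (integral {x..x + h} f - h *\<^sub>R f x) \<le> e * h"
    using right_average_tendsto_AE[OF int] by blast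
  \<comment> \<open>Left difference quotients of \<open>f\<close> are right ones of its reflection.\<close>
  have int': "(\<lambda>y. f (- y)) integrable_on {s..t}" for s t
    using Henstock_Kurzweil_Integration.integrable_reflect_real[of f "-s" "-t"] int[of "-t" "-s"] by simp
  obtain M where M: "negligible M"
    "\<And>x e. x \<notin> M \<Longrightarrow> 0 < e \<Longrightarrow>
       \<exists>d>0. \<forall>h. 0 < h \<and> h < d \<longrightarrow> norm (integral {x..x + h} (\<lambda>y. f (- y)) - h *\<^sub>R f (- x)) \<le> e * h"
    using right_average_tendsto_AE[OF int'] by blast
  show ?thesis
  proof (rule that[of "N \<union> uminus ` M"])
    have "negligible (uminus ` M)"
      using M(1) by (intro negligible_differentiable_image_negligible) (auto intro!: derivative_intros)
    then show "negligible (N \<union> uminus ` M)"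
      using N(1) by simp
    fix a x assume x: "x \<notin> N \<union> uminus ` M" "a < x"
    then have xM: "- x \<notin> M" by (metis Un_iff imageI minus_minus)
    show "((\<lambda>t. integral {a..t} f) has_vector_derivative f x) (at x)"
      unfolding has_vector_derivative_def has_derivative_at_alt
    proof (intro conjI allI impI bounded_linear_scaleR_left)
      fix e :: real assume "0 < e"
      obtain d1 where d1: "d1 > 0"
        "\<And>h. 0 < h \<Longrightarrow> h < d1 \<Longrightarrow> norm (integral {x..x + h} f - h *\<^sub>R f x) \<le> e * h"
        using N(2)[of x e] x \<open>0 < e\<close> by auto
      obtain d2 where d2: "d2 > 0"
        "\<And>h. 0 < h \<Longrightarrow> h < d2 \<Longrightarrow> norm (integral {-x..-x + h} (\<lambda>y. f (- y)) - h *\<^sub>R f x) \<le> e * h"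
        using M(2)[OF xM \<open>0 < e\<close>] by auto
      \<comment> \<open>Keeping \<open>y\<close> closer to \<open>x\<close> than
        \<open>x - a\<close> ensures \<open>y > a\<close>, so that the integral from
        \<open>a\<close> can be split at \<open>x\<close> or at \<open>y\<close>.\<close>
      have "norm (integral {a..y} f - integral {a..x} f - (y - x) *\<^sub>R f x) \<le> e * norm (y - x)"
        if y: "norm (y - x) < Min {d1, d2, x - a}" for y
      proof (cases x y rule: linorder_cases)
        case less
        then have "integral {a..x} f + integral {x..y} f = integral {a..y} f"
          using x(2) by (intro Henstock_Kurzweil_Integration.integral_combine int) auto
        then have "integral {a..y} f - integral {a..x} f = integral {x..y} f"
          by (simp add: algebra_simps)
        then show ?thesis
          using d1(2)[of "y - x"] y less by simp
      next
        case greater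
        then have "integral {a..y} f + integral {y..x} f = integral {a..x} f"
          using y by (intro Henstock_Kurzweil_Integration.integral_combine int) auto
        moreover have "integral {-x..-x + (x - y)} (\<lambda>z. f (- z)) = integral {y..x} f"
          using Henstock_Kurzweil_Integration.integral_reflect_real[of x y f] by simp
        ultimately have "integral {a..y} f - integral {a..x} f - (y - x) *\<^sub>R f x
            = - (integral {-x..-x + (x - y)} (\<lambda>z. f (- z)) - (x - y) *\<^sub>R f x)"
          by (simp add: algebra_simps)
        also have "norm \<dots> \<le> e * (x - y)"
          using d2(2)[of "x - y"] y greater by (simp only: norm_minus_cancel) auto
        finally show ?thesis using greater by simp
      qed simp
      moreover have "Min {d1, d2, x - a} > 0" using d1 d2 x by simp
      ultimately show "\<exists>d>0. \<forall>y. norm (y - x) < d \<longrightarrow>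
          norm (integral {a..y} f - integral {a..x} f - (y - x) *\<^sub>R f x) \<le> e * norm (y - x)"
        by blast
    qed
  qed
qed

text \<open>Differentiating the indefinite integral of the density identifies the density with the
  derivative. The endpoints are left out because \<open>vector_derivative f (at t)\<close> is
  two-sided while \<open>f\<close> is controlled on \<open>{a..b}\<close> only.\<close>

theorem absolutely_continuous_ftc:
  fixes f :: "real \<Rightarrow> 'a::euclidean_space"
  assumes "a < b" "absolutely_continuous_on a b f"
  obtains g :: "real \<Rightarrow> 'a" and N where "integrable lborel g" "negligible N"
    "\<And>t. a \<le> t \<Longrightarrow> t \<le> b \<Longrightarrow> f t - f a = (LINT s:{a..t}|lborel. g s)"
    "\<And>t. a < t \<Longrightarrow> t < b \<Longrightarrow> t \<notin> N \<Longrightarrow> vector_derivative f (at t) = g t"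
proof -
  obtain g where g: "integrable lborel g"
    "\<And>t. a \<le> t \<Longrightarrow> t \<le> b \<Longrightarrow> f t - f a = (LINT s:{a..t}|lborel. g s)"
    using absolutely_continuous_density[OF assms] by blast
  have "set_integrable lborel {s..t} g" for s t
    unfolding set_integrable_def by (rule integrable_mult_indicator[OF _ g(1)]) simp
  note g' = set_borel_integral_eq_integral[OF this]
  obtain N where N: "negligible N"
    "\<And>a x. x \<notin> N \<Longrightarrow> a < x \<Longrightarrow> ((\<lambda>t. integral {a..t} g) has_vector_derivative g x) (at x)"
    using indefinite_integral_has_vector_derivative_AE[OF g'(1)] by blast
  have "vector_derivative f (at t) = g t" if t: "a < t" "t < b" "t \<notin> N" for t
  proof -
    have "((\<lambda>t. f a + integral {a..t} g) has_vector_derivative 0 + g t) (at t)"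
      using N(2)[OF t(3,1)] by (intro has_vector_derivative_add) auto
    then have "(f has_vector_derivative 0 + g t) (at t)"
    proof (rule has_vector_derivative_transform_within_open[of _ _ _ "{a<..<b}"])
      show "f a + integral {a..s} g = f s" if "s \<in> {a<..<b}" for s
        using g(2)[of s] that by (simp add: g' algebra_simps)
    qed (use t in auto)
    then show ?thesis by (simp add: vector_derivative_at)
  qed
  then show ?thesis using that[OF g(1) N(1) g(2)] by blast
qed

section \<open>Hoelder interpolation and weights\<close>

lemma ennreal_powr_mono: "0 \<le> s \<Longrightarrow> x \<le> y \<Longrightarrow> ennreal_powr x s \<le> ennreal_powr y s"
  by (cases x; cases y) (auto simp: ennreal_powr_def powr_mono2 top_unique intro!: ennreal_leI)

lemma ennreal_powr_zero [simp]: "ennreal_powr x 0 = 1"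
  by (simp add: ennreal_powr_def)

lemma ennreal_powr_one [simp]: "ennreal_powr x 1 = x"
  by (cases x) (auto simp: ennreal_powr_def)

lemma ennreal_powr_ennreal: "0 \<le> x \<Longrightarrow> s \<noteq> 0 \<Longrightarrow> ennreal_powr (ennreal x) s = ennreal (x powr s)"
  by (simp add: ennreal_powr_def)

lemma ennreal_powr_pos: "0 < x \<Longrightarrow> ennreal_powr (ennreal x) s = ennreal (x powr s)"
  by (simp add: ennreal_powr_def)

lemma ennreal_powr_top: "s \<noteq> 0 \<Longrightarrow> ennreal_powr top s = top"
  by (simp add: ennreal_powr_def)

lemma ennreal_powr_eq_0: "s \<noteq> 0 \<Longrightarrow> ennreal_powr x s = 0 \<longleftrightarrow> x = 0"
  by (cases x) (auto simp: ennreal_powr_ennreal ennreal_powr_top)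

text \<open>Infinite factors do no harm: for \<open>s > 0\<close> the power maps 0 to 0 and
  \<open>top\<close> to \<open>top\<close>, in accordance with \<open>0 * top = 0\<close>; for
  \<open>s = 0\<close> every power is 1.\<close>

lemma ennreal_powr_mult:
  assumes "0 \<le> s"
  shows "ennreal_powr (x * y) s = ennreal_powr x s * ennreal_powr y s"
proof (cases "s = 0")
  case False
  show ?thesis
  proof (cases "x = top \<or> y = top")
    case True
    then show ?thesis
      using False ennreal_powr_eq_0[OF False, of x] ennreal_powr_eq_0[OF False, of y] ennreal_powr_eq_0[OF False, of 0]
      by (auto simp: ennreal_top_mult ennreal_mult_top ennreal_powr_top)
  next
    case F: False
    then obtain x' y' where "x = ennreal x'" "0 \<le> x'" "y = ennreal y'" "0 \<le> y'"
      by (metis ennreal_cases)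
    then show ?thesis
      using False by (simp add: ennreal_powr_ennreal powr_mult flip: ennreal_mult)
  qed
qed simp

lemma ennreal_powr_powr:
  "0 \<le> s \<Longrightarrow> 0 \<le> t \<Longrightarrow> ennreal_powr (ennreal_powr x s) t = ennreal_powr x (s * t)"
  by (cases x; cases "s = 0"; cases "t = 0")
     (auto simp: ennreal_powr_ennreal ennreal_powr_top powr_powr ennreal_powr_def[of 1])

text \<open>Completing a measure does not change the nonnegative integral, even of a nonmeasurable
  function, so the estimates can be carried out over \<open>lborel\<close>.\<close>

lemma Lp_norm_lborel:
  "Lp_norm r a b f = ennreal_powr (\<integral>\<^sup>+x\<in>{a<..<b}. ennreal (norm (f x) powr r) \<partial>lborel) (1 / r)"
  by (simp add: Lp_norm_def nn_integral_completion)

lemma Lp_norm_cong: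
  assumes "\<And>x. a < x \<Longrightarrow> x < b \<Longrightarrow> norm (f x) = norm (g x)"
  shows "Lp_norm r a b f = Lp_norm r a b g"
  unfolding Lp_norm_def using assms
  by (intro arg_cong2[of _ _ _ _ ennreal_powr] nn_integral_cong) (auto simp: indicator_def)

text \<open>Measurability is stated for the norm of \<open>g\<close> cut off to the interval, since
  nothing is assumed on \<open>u\<close> outside it; it serves to pull the constant out of the
  integral.\<close>

lemma Lp_norm_le_scale:
  assumes "0 < r" "0 < M"
    and g: "(\<lambda>x. indicator {a<..<b} x * norm (g x)) \<in> borel_measurable borel"
    and le: "\<And>x. a < x \<Longrightarrow> x < b \<Longrightarrow> norm (f x) \<le> M * norm (g x)"
  shows "Lp_norm r a b f \<le> ennreal M * Lp_norm r a b g"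
proof -
  have eq: "ennreal (norm (g x) powr r) * indicator {a<..<b} x = ennreal ((indicator {a<..<b} x * norm (g x)) powr r)" for x
    using assms(1) by (simp add: indicator_def)
  have [measurable]: "(\<lambda>x. ennreal (norm (g x) powr r) * indicator {a<..<b} x) \<in> borel_measurable borel"
    unfolding eq using g by measurable
  have "(\<integral>\<^sup>+x\<in>{a<..<b}. ennreal (norm (f x) powr r) \<partial>lborel)
      \<le> (\<integral>\<^sup>+x. ennreal (M powr r) * (ennreal (norm (g x) powr r) * indicator {a<..<b} x) \<partial>lborel)"
  proof (rule nn_integral_mono)
    fix x
    have "norm (f x) powr r \<le> M powr r * norm (g x) powr r" if "a < x" "x < b"
      using powr_mono2[of r "norm (f x)" "M * norm (g x)"] le[OF that] assms(1,2)
      by (simp add: powr_mult)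
    then show "ennreal (norm (f x) powr r) * indicator {a<..<b} x
        \<le> ennreal (M powr r) * (ennreal (norm (g x) powr r) * indicator {a<..<b} x)"
      by (auto simp: indicator_def ennreal_mult[symmetric] intro!: ennreal_leI)
  qed
  also have "\<dots> = ennreal (M powr r) * (\<integral>\<^sup>+x\<in>{a<..<b}. ennreal (norm (g x) powr r) \<partial>lborel)"
    by (rule nn_integral_cmult) measurable
  finally have "Lp_norm r a b f \<le> ennreal_powr (ennreal (M powr r) * (\<integral>\<^sup>+x\<in>{a<..<b}. ennreal (norm (g x) powr r) \<partial>lborel)) (1 / r)"
    unfolding Lp_norm_lborel using assms(1) by (intro ennreal_powr_mono) auto
  also have "\<dots> = ennreal M * Lp_norm r a b g"
    using assms(1,2) by (simp add: ennreal_powr_mult ennreal_powr_ennreal powr_powr Lp_norm_lborel)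
  finally show ?thesis .
qed

section \<open>Hoelder's inequality and interpolation of norms\<close>

text \<open>Young's inequality is applied to \<open>f x / A\<close> and \<open>g x / B\<close>, with
  \<open>A\<close> and \<open>B\<close> the two integrals, and then integrated; the weights \<theta>
  and 1 - \<theta> add up to 1. Zero and infinite integrals are separated first because they cannot
  be divided out.\<close>

lemma nn_integral_Hoelder:
  fixes f g :: "'a \<Rightarrow> real"
  assumes [measurable]: "f \<in> borel_measurable M" "g \<in> borel_measurable M"
    and nonneg: "\<And>x. 0 \<le> f x" "\<And>x. 0 \<le> g x" and \<theta>: "0 < \<theta>" "\<theta> < 1"
  shows "(\<integral>\<^sup>+x. ennreal (f x powr \<theta> * g x powr (1 - \<theta>)) \<partial>M)
    \<le> ennreal_powr (\<integral>\<^sup>+x. ennreal (f x) \<partial>M) \<theta> * ennreal_powr (\<integral>\<^sup>+x. ennreal (g x) \<partial>M) (1 - \<theta>)"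
    (is "?L \<le> ennreal_powr ?A \<theta> * ennreal_powr ?B (1 - \<theta>)")
proof (cases "?A = 0 \<or> ?B = 0")
  case True
  then have "AE x in M. f x = 0 \<or> g x = 0"
  proof
    assume "?A = 0"
    then have "AE x in M. ennreal (f x) = 0" by (subst (asm) nn_integral_0_iff_AE) auto
    then show ?thesis by eventually_elim (use nonneg in \<open>auto simp: ennreal_eq_0_iff intro: antisym\<close>)
  next
    assume "?B = 0"
    then have "AE x in M. ennreal (g x) = 0" by (subst (asm) nn_integral_0_iff_AE) auto
    then show ?thesis by eventually_elim (use nonneg in \<open>auto simp: ennreal_eq_0_iff intro: antisym\<close>)
  qed
  then have "AE x in M. ennreal (f x powr \<theta> * g x powr (1 - \<theta>)) = 0"
    by eventually_elim auto
  then have "?L = 0"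
    by (subst nn_integral_0_iff_AE) auto
  then show ?thesis by simp
next
  case AB0: False
  show ?thesis
  proof (cases "?A = top \<or> ?B = top")
    case True
    then show ?thesis
      using AB0 \<theta> ennreal_powr_eq_0[of \<theta> ?A] ennreal_powr_eq_0[of "1 - \<theta>" ?B]
      by (auto simp: ennreal_powr_top ennreal_top_mult ennreal_mult_top)
  next
    case False
    then obtain A B where AB: "?A = ennreal A" "0 \<le> A" "?B = ennreal B" "0 \<le> B"
      by (metis ennreal_cases)
    then have pos: "A > 0" "B > 0" using AB0 by (auto simp: less_le)
    \<comment> \<open>\<open>K\<close> is the right-hand side of the claim; multiplying by it undoes
      the normalisation by \<open>A\<close> and \<open>B\<close>.\<close>
    define K where "K = A powr \<theta> * B powr (1 - \<theta>)"
    have "?L \<le> (\<integral>\<^sup>+x. ennreal (K * \<theta> / A) * ennreal (f x) + ennreal (K * (1 - \<theta>) / B) * ennreal (g x) \<partial>M)"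
    proof (rule nn_integral_mono)
      fix x
      have "f x powr \<theta> * g x powr (1 - \<theta>) \<le> K * \<theta> / A * f x + K * (1 - \<theta>) / B * g x"
      proof (cases "f x = 0 \<or> g x = 0")
        case True
        then show ?thesis using nonneg[of x] \<theta> pos by (auto simp: K_def)
      next
        case False
        then have "f x > 0" "g x > 0" using nonneg[of x] by auto
        then have "K * ((f x / A) powr \<theta> * (g x / B) powr (1 - \<theta>)) \<le> K * (\<theta> * (f x / A) + (1 - \<theta>) * (g x / B))"
          using \<theta> pos by (intro mult_left_mono Youngs_inequality_0) (auto simp: K_def)
        moreover have "K * ((f x / A) powr \<theta> * (g x / B) powr (1 - \<theta>)) = f x powr \<theta> * g x powr (1 - \<theta>)"
          using pos \<open>f x > 0\<close> \<open>g x > 0\<close> by (simp add: K_def powr_divide)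
        ultimately show ?thesis by (simp add: algebra_simps)
      qed
      then show "ennreal (f x powr \<theta> * g x powr (1 - \<theta>))
          \<le> ennreal (K * \<theta> / A) * ennreal (f x) + ennreal (K * (1 - \<theta>) / B) * ennreal (g x)"
        using nonneg[of x] pos \<theta> by (simp add: ennreal_mult[symmetric] K_def ennreal_plus[symmetric] ennreal_leI del: ennreal_plus)
    qed
    also have "\<dots> = ennreal (K * \<theta> / A) * ?A + ennreal (K * (1 - \<theta>) / B) * ?B"
      by (simp add: nn_integral_add nn_integral_cmult)
    also have "\<dots> = ennreal (K * \<theta> / A * A + K * (1 - \<theta>) / B * B)"
      unfolding AB using pos \<theta> by (simp add: ennreal_mult[symmetric] K_def ennreal_plus[symmetric] del: ennreal_plus)
    also have "K * \<theta> / A * A + K * (1 - \<theta>) / B * B = K"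
      using pos by (simp add: field_simps)
    also have "ennreal K = ennreal_powr ?A \<theta> * ennreal_powr ?B (1 - \<theta>)"
      unfolding AB K_def using pos \<theta> by (simp add: ennreal_powr_ennreal ennreal_mult)
    finally show ?thesis .
  qed
qed

text \<open>Hoelder's inequality, with |u|^r split into a power of |u|^p and a power of
  |u|^q.\<close>

lemma Lp_norm_interpolation_interior:
  fixes u :: "real \<Rightarrow> 'a::real_normed_vector"
  assumes pos: "0 < p" "0 < q" "0 < r" and \<delta>: "0 < \<delta>" "\<delta> < 1"
    and r: "\<delta> / p + (1 - \<delta>) / q = 1 / r"
    and u: "(\<lambda>x. indicator {a<..<b} x * norm (u x)) \<in> borel_measurable borel"
  shows "Lp_norm r a b u \<le> ennreal_powr (Lp_norm p a b u) \<delta> * ennreal_powr (Lp_norm q a b u) (1 - \<delta>)"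
proof -
  define v where "v x = indicator {a<..<b} x * norm (u x)" for x
  have [measurable]: "v \<in> borel_measurable borel" using u unfolding v_def .
  have v: "ennreal (norm (u x) powr s) * indicator {a<..<b} x = ennreal (v x powr s)" if "0 < s" for x s
    using that by (simp add: v_def indicator_def)
  \<comment> \<open>The final root forces \<theta>: \<theta>/r has to be \<delta>/p. The relation
    between the exponents then makes (1 - \<theta>)/r equal to (1 - \<delta>)/q.\<close>
  define \<theta> where "\<theta> = r * \<delta> / p"
  have "r * \<delta> / p + r * (1 - \<delta>) / q = r * (\<delta> / p + (1 - \<delta>) / q)"
    by (simp add: distrib_left)
  also have "\<dots> = 1" unfolding r using pos by simp
  finally have \<theta>': "1 - \<theta> = r * (1 - \<delta>) / q" by (simp add: \<theta>_def)
  have \<theta>: "0 < \<theta>" "\<theta> < 1"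
  proof -
    have "0 < r * (1 - \<delta>) / q" using pos \<delta> by simp
    then show "\<theta> < 1" using \<theta>' by linarith
  qed (use pos \<delta> in \<open>simp add: \<theta>_def\<close>)
  have "v x powr r = (v x powr p) powr \<theta> * (v x powr q) powr (1 - \<theta>)" for x
  proof -
    have "p * \<theta> + q * (1 - \<theta>) = r"
      unfolding \<theta>' using pos by (simp add: \<theta>_def field_simps)
    then show ?thesis by (simp add: powr_powr powr_add[symmetric])
  qed
  then have "(\<integral>\<^sup>+x. ennreal (v x powr r) \<partial>lborel) \<le>
      ennreal_powr (\<integral>\<^sup>+x. ennreal (v x powr p) \<partial>lborel) \<theta> * ennreal_powr (\<integral>\<^sup>+x. ennreal (v x powr q) \<partial>lborel) (1 - \<theta>)"
    using nn_integral_Hoelder[of "\<lambda>x. v x powr p" lborel "\<lambda>x. v x powr q" \<theta>] \<theta> by simp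
  then have "Lp_norm r a b u \<le> ennreal_powr (ennreal_powr (\<integral>\<^sup>+x. ennreal (v x powr p) \<partial>lborel) \<theta> * ennreal_powr (\<integral>\<^sup>+x. ennreal (v x powr q) \<partial>lborel) (1 - \<theta>)) (1 / r)"
    unfolding Lp_norm_lborel v[OF pos(3)] using pos by (intro ennreal_powr_mono) auto
  also have "\<dots> = ennreal_powr (Lp_norm p a b u) \<delta> * ennreal_powr (Lp_norm q a b u) (1 - \<delta>)"
  proof -
    have "\<theta> * (1 / r) = 1 / p * \<delta>" "(1 - \<theta>) * (1 / r) = 1 / q * (1 - \<delta>)"
      unfolding \<theta>' using pos by (simp_all add: \<theta>_def)
    then show ?thesis
      unfolding Lp_norm_lborel v[OF pos(1)] v[OF pos(2)] using pos \<delta> \<theta>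
      by (simp only: ennreal_powr_mult ennreal_powr_powr less_imp_le zero_le_divide_iff zero_le_one
          diff_ge_0_iff_ge simp_thms)
  qed
  finally show ?thesis .
qed

text \<open>At \<delta> = 0 and \<delta> = 1 the relation gives r = q and r = p, and the factor with
  power 0 is 1 even if its norm is 0 or infinite.\<close>

lemma Lp_norm_interpolation:
  fixes u :: "real \<Rightarrow> 'a::real_normed_vector"
  assumes pos: "0 < p" "0 < q" "0 < r" and \<delta>: "0 \<le> \<delta>" "\<delta> \<le> 1"
    and r: "\<delta> / p + (1 - \<delta>) / q = 1 / r"
    and u: "(\<lambda>x. indicator {a<..<b} x * norm (u x)) \<in> borel_measurable borel"
  shows "Lp_norm r a b u \<le> ennreal_powr (Lp_norm p a b u) \<delta> * ennreal_powr (Lp_norm q a b u) (1 - \<delta>)"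
proof -
  consider "\<delta> = 0" | "\<delta> = 1" | "0 < \<delta>" "\<delta> < 1" using \<delta> by linarith
  then show ?thesis
  proof cases
    case 1
    then have "r = q" using r pos by simp
    then show ?thesis using 1 by simp
  next
    case 2
    then have "r = p" using r pos by simp
    then show ?thesis using 2 by simp
  next
    case 3
    then show ?thesis using Lp_norm_interpolation_interior[OF pos 3 r u] by simp
  qed
qed

section \<open>Power weights on an interval away from 0\<close>

text \<open>On the positive half-line \<open>x powr c\<close> is monotone, in a direction given by
  the sign of \<open>c\<close>, so its values at the endpoints bound it.\<close>

lemma powr_weight_bounds:
  fixes a b c :: real
  assumes "0 < a" "a < b"
  obtains m M where "0 < m" "0 < M" "\<And>x. a < x \<Longrightarrow> x < b \<Longrightarrow> m \<le> x powr c \<and> x powr c \<le> M"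
proof (rule that[of "min (a powr c) (b powr c)" "max (a powr c) (b powr c)"])
  fix x assume "a < x" "x < b"
  then show "min (a powr c) (b powr c) \<le> x powr c \<and> x powr c \<le> max (a powr c) (b powr c)"
    using assms powr_mono2[of c a x] powr_mono2[of c x b] powr_mono2'[of c a x] powr_mono2'[of c x b]
    by (cases "0 \<le> c") auto
qed (use assms in \<open>auto simp: less_max_iff_disj\<close>)

text \<open>\<open>M\<close> is chosen before \<open>f\<close>; this order of quantifiers keeps the
  final constant independent of the function.\<close>

lemma weighted_Lp_norm_bounds:
  fixes a b c r :: real
  assumes "0 < a" "a < b" "0 < r"
  obtains M where "0 < M"
    "\<And>f :: real \<Rightarrow> 'a::real_normed_vector. (\<lambda>x. indicator {a<..<b} x * norm (f x)) \<in> borel_measurable borel \<Longrightarrow>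
       Lp_norm r a b (\<lambda>x. (x powr c) *\<^sub>R f x) \<le> ennreal M * Lp_norm r a b f \<and>
       Lp_norm r a b f \<le> ennreal M * Lp_norm r a b (\<lambda>x. (x powr c) *\<^sub>R f x)"
proof -
  obtain m M where m: "0 < m" "0 < M" and M: "\<And>x. a < x \<Longrightarrow> x < b \<Longrightarrow> m \<le> x powr c \<and> x powr c \<le> M"
    using powr_weight_bounds[OF assms(1,2)] by metis
  \<comment> \<open>\<open>M\<close> bounds the weight and \<open>1 / m\<close> its reciprocal; the
    larger one serves for both inequalities.\<close>
  define L where "L = max M (1 / m)"
  have "0 < L" using m by (auto simp: L_def)
  moreover have "Lp_norm r a b (\<lambda>x. (x powr c) *\<^sub>R f x) \<le> ennreal L * Lp_norm r a b f \<and>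
       Lp_norm r a b f \<le> ennreal L * Lp_norm r a b (\<lambda>x. (x powr c) *\<^sub>R f x)"
    if [measurable]: "(\<lambda>x. indicator {a<..<b} x * norm (f x)) \<in> borel_measurable borel" for f :: "real \<Rightarrow> 'a"
  proof (intro conjI Lp_norm_le_scale assms \<open>0 < L\<close>)
    show "norm (x powr c *\<^sub>R f x) \<le> L * norm (f x)" if "a < x" "x < b" for x
      using M[OF that] by (auto simp: L_def intro!: mult_right_mono)
    show "norm (f x) \<le> L * norm (x powr c *\<^sub>R f x)" if "a < x" "x < b" for x
    proof -
      have "1 = (1 / m) * m" using m by simp
      also have "\<dots> \<le> L * x powr c"
        using M[OF that] m by (intro mult_mono) (auto simp: L_def)
      finally have "1 * norm (f x) \<le> (L * x powr c) * norm (f x)"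
        by (rule mult_right_mono) simp
      then show ?thesis by simp
    qed
    have "(\<lambda>x. indicator {a<..<b} x * norm (x powr c *\<^sub>R f x)) = (\<lambda>x. x powr c * (indicator {a<..<b} x * norm (f x)))"
      by auto
    then show "(\<lambda>x. indicator {a<..<b} x * norm (x powr c *\<^sub>R f x)) \<in> borel_measurable borel"
      by (simp only:) measurable
  qed (rule that)
  ultimately show ?thesis using that by blast
qed

section \<open>The Abel kernel\<close>

text \<open>The Riemann-Liouville kernel without its Gamma factor. The value 0 on the nonpositive
  axis turns integrals up to \<open>t\<close> into integrals over the whole line.\<close>

definition abel_kernel :: "real \<Rightarrow> real \<Rightarrow> real" where
  "abel_kernel \<beta> x = (if 0 < x then x powr (\<beta> - 1) else 0)"

lemma abel_kernel_measurable [measurable]: "abel_kernel \<beta> \<in> borel_measurable borel"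
  unfolding abel_kernel_def by measurable

lemma abel_kernel_nonneg [simp]: "0 \<le> abel_kernel \<beta> x"
  by (simp add: abel_kernel_def)

lemma nn_integral_abel_kernel:
  assumes "0 < \<beta>" "0 \<le> T"
  shows "(\<integral>\<^sup>+x\<in>{..T}. ennreal (abel_kernel \<beta> x) \<partial>lborel) = ennreal (T powr \<beta> / \<beta>)"
proof -
  have "(\<integral>\<^sup>+x\<in>{..T}. ennreal (abel_kernel \<beta> x) \<partial>lborel) = (\<integral>\<^sup>+x. ennreal (x powr (\<beta> - 1)) * indicator {0..T} x \<partial>lborel)"
    by (intro nn_integral_cong) (auto simp: indicator_def abel_kernel_def)
  also have "\<dots> = ennreal (T powr \<beta> / \<beta>)"
    using has_integral_powr_from_0[of "\<beta> - 1" T] assms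
    by (intro nn_integral_has_integral_lebesgue') auto
  finally show ?thesis .
qed

text \<open>Substituting \<open>s = \<tau> + (t - \<tau>) * x\<close> yields the Beta integral B(1 -
  \<alpha>, \<alpha>), whose denominator is Gamma 1 = 1.\<close>

lemma abel_kernel_convolution:
  assumes \<alpha>: "0 < \<alpha>" "\<alpha> < 1"
  shows "(\<integral>\<^sup>+s. ennreal (abel_kernel \<alpha> (t - s) * abel_kernel (1 - \<alpha>) (s - \<tau>)) \<partial>lborel)
    = ennreal (Gamma \<alpha> * Gamma (1 - \<alpha>)) * indicator {..<t} \<tau>"
proof (cases "\<tau> < t")
  case False
  then have "abel_kernel \<alpha> (t - s) * abel_kernel (1 - \<alpha>) (s - \<tau>) = 0" for s
    by (auto simp: abel_kernel_def)
  with False show ?thesis by (simp only:) simp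
next
  case True
  define c where "c = t - \<tau>"
  have "c > 0" using True by (simp add: c_def)
  have "(\<integral>\<^sup>+s. ennreal (abel_kernel \<alpha> (t - s) * abel_kernel (1 - \<alpha>) (s - \<tau>)) \<partial>lborel)
    = ennreal \<bar>c\<bar> * (\<integral>\<^sup>+x. ennreal (abel_kernel \<alpha> (t - (\<tau> + c * x)) * abel_kernel (1 - \<alpha>) ((\<tau> + c * x) - \<tau>)) \<partial>lborel)"
    using \<open>c > 0\<close> by (intro nn_integral_real_affine) auto
  also have "\<dots> = (\<integral>\<^sup>+x. ennreal \<bar>c\<bar> * ennreal (abel_kernel \<alpha> (t - (\<tau> + c * x)) * abel_kernel (1 - \<alpha>) ((\<tau> + c * x) - \<tau>)) \<partial>lborel)"
    by (rule nn_integral_cmult[symmetric]) measurable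
  also have "\<dots> = (\<integral>\<^sup>+x. ennreal (x powr ((1 - \<alpha>) - 1) * (1 - x) powr (\<alpha> - 1)) * indicator {0..1} x \<partial>lborel)"
  proof (rule nn_integral_cong)
    fix x
    have t: "t - (\<tau> + c * x) = c * (1 - x)" by (simp add: c_def algebra_simps)
    have "c * (abel_kernel \<alpha> (c * (1 - x)) * abel_kernel (1 - \<alpha>) (c * x))
        = x powr ((1 - \<alpha>) - 1) * (1 - x) powr (\<alpha> - 1) * indicator {0..1} x"
    proof (cases "0 < x \<and> x < 1")
      case True
      \<comment> \<open>The exponents 1, \<alpha> - 1 and -\<alpha> add up to 0, so the substitution
        leaves no power of \<open>c\<close>.\<close>
      have "c * (c powr (\<alpha> - 1) * c powr (- \<alpha>)) = c * c powr (- 1)"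
        by (simp add: powr_add[symmetric])
      also have "\<dots> = 1" using \<open>c > 0\<close> by (simp add: powr_minus)
      finally have one: "c * (c powr (\<alpha> - 1) * c powr (- \<alpha>)) = 1" .
      have "c * (abel_kernel \<alpha> (c * (1 - x)) * abel_kernel (1 - \<alpha>) (c * x))
          = c * ((c * (1 - x)) powr (\<alpha> - 1) * (c * x) powr (- \<alpha>))"
        using True \<open>c > 0\<close> by (simp add: abel_kernel_def)
      also have "\<dots> = (c * (c powr (\<alpha> - 1) * c powr (- \<alpha>))) * (x powr (- \<alpha>) * (1 - x) powr (\<alpha> - 1))"
        using True \<open>c > 0\<close> by (simp add: powr_mult)
      finally show ?thesis using True one by simp
    next
      case False
      then show ?thesis using \<open>c > 0\<close>
        by (auto simp: abel_kernel_def indicator_def zero_less_mult_iff)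
    qed
    then show "ennreal \<bar>c\<bar> * ennreal (abel_kernel \<alpha> (t - (\<tau> + c * x)) * abel_kernel (1 - \<alpha>) ((\<tau> + c * x) - \<tau>))
        = ennreal (x powr ((1 - \<alpha>) - 1) * (1 - x) powr (\<alpha> - 1)) * indicator {0..1} x"
      using \<open>c > 0\<close> by (simp add: t ennreal_mult[symmetric] ennreal_indicator[symmetric] del: ennreal_indicator)
  qed
  also have "\<dots> = ennreal (Beta (1 - \<alpha>) \<alpha>)"
    using \<alpha> by (intro nn_integral_has_integral_lebesgue' has_integral_Beta_real) auto
  finally show ?thesis using True by (simp add: Beta_def mult.commute)
qed

text \<open>Fubini's theorem reduces the iterated integral to the convolution of the two kernels,
  which is constant for \<tau> < t. Up to Gamma factors this is the semigroup law of fractional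
  integrals for the orders \<alpha> and 1 - \<alpha>.\<close>

lemma abel_inversion:
  fixes g :: "real \<Rightarrow> 'a::{banach, second_countable_topology}"
  assumes \<alpha>: "0 < \<alpha>" "\<alpha> < 1" and g: "integrable lborel g"
  shows "(LINT s|lborel. abel_kernel \<alpha> (t - s) *\<^sub>R (LINT \<tau>|lborel. abel_kernel (1 - \<alpha>) (s - \<tau>) *\<^sub>R g \<tau>))
    = (Gamma \<alpha> * Gamma (1 - \<alpha>)) *\<^sub>R (LINT \<tau>|lborel. indicator {..<t} \<tau> *\<^sub>R g \<tau>)"
proof -
  define k where "k s \<tau> = abel_kernel \<alpha> (t - s) * abel_kernel (1 - \<alpha>) (s - \<tau>)" for s \<tau>
  let ?C = "Gamma \<alpha> * Gamma (1 - \<alpha>)"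
  have C: "?C \<ge> 0" using \<alpha> by (intro mult_nonneg_nonneg less_imp_le Gamma_real_pos) auto
  have [measurable]: "g \<in> borel_measurable borel" using borel_measurable_integrable[OF g] by simp
  have k[measurable]: "case_prod k \<in> borel_measurable (borel \<Otimes>\<^sub>M borel)"
    unfolding k_def case_prod_beta by measurable
  have k0: "0 \<le> k s \<tau>" for s \<tau> by (simp add: k_def)
  have kI: "(\<integral>\<^sup>+s. ennreal (k s \<tau>) \<partial>lborel) = ennreal (?C * indicator {..<t} \<tau>)" for \<tau>
    unfolding k_def abel_kernel_convolution[OF \<alpha>] using C by (simp add: ennreal_mult' ennreal_indicator)
  have meas: "(\<lambda>(s, \<tau>). k s \<tau> *\<^sub>R g \<tau>) \<in> borel_measurable (lborel \<Otimes>\<^sub>M lborel)"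
    unfolding case_prod_beta k_def by measurable
  \<comment> \<open>By Tonelli's theorem, integrating in \<open>s\<close> first leaves at most a
    constant times the norm of \<open>g\<close>.\<close>
  have "integrable (lborel \<Otimes>\<^sub>M lborel) (\<lambda>(s, \<tau>). k s \<tau> *\<^sub>R g \<tau>)"
  proof (rule integrableI_bounded[OF meas])
    have "(\<integral>\<^sup>+x. ennreal (norm (case x of (s, \<tau>) \<Rightarrow> k s \<tau> *\<^sub>R g \<tau>)) \<partial>(lborel \<Otimes>\<^sub>M lborel))
        = (\<integral>\<^sup>+\<tau>. \<integral>\<^sup>+s. ennreal (norm (k s \<tau> *\<^sub>R g \<tau>)) \<partial>lborel \<partial>lborel)"
      using meas by (subst lborel_pair.nn_integral_snd[symmetric]) auto
    also have "\<dots> = (\<integral>\<^sup>+\<tau>. ennreal (?C * indicator {..<t} \<tau>) * ennreal (norm (g \<tau>)) \<partial>lborel)"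
    proof (rule nn_integral_cong)
      fix \<tau>
      have "(\<integral>\<^sup>+s. ennreal (norm (k s \<tau> *\<^sub>R g \<tau>)) \<partial>lborel) = (\<integral>\<^sup>+s. ennreal (k s \<tau>) * ennreal (norm (g \<tau>)) \<partial>lborel)"
        using k0 by (intro nn_integral_cong) (simp add: ennreal_mult)
      also have "\<dots> = (\<integral>\<^sup>+s. ennreal (k s \<tau>) \<partial>lborel) * ennreal (norm (g \<tau>))"
        by (rule nn_integral_multc) (simp add: k_def)
      finally show "(\<integral>\<^sup>+s. ennreal (norm (k s \<tau> *\<^sub>R g \<tau>)) \<partial>lborel) = ennreal (?C * indicator {..<t} \<tau>) * ennreal (norm (g \<tau>))"
        by (simp only: kI)
    qed
    also have "\<dots> \<le> (\<integral>\<^sup>+\<tau>. ennreal ?C * ennreal (norm (g \<tau>)) \<partial>lborel)"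
      using C by (intro nn_integral_mono mult_right_mono ennreal_leI) (auto simp: indicator_def)
    also have "\<dots> = ennreal ?C * (\<integral>\<^sup>+\<tau>. ennreal (norm (g \<tau>)) \<partial>lborel)"
      by (rule nn_integral_cmult) measurable
    also have "\<dots> < \<infinity>"
      using g by (simp add: integrable_iff_bounded ennreal_mult_less_top)
    finally show "(\<integral>\<^sup>+x. ennreal (norm (case x of (s, \<tau>) \<Rightarrow> k s \<tau> *\<^sub>R g \<tau>)) \<partial>(lborel \<Otimes>\<^sub>M lborel)) < \<infinity>" .
  qed
  from lborel_pair.Fubini_integral[OF this]
  have "(LINT s|lborel. LINT \<tau>|lborel. k s \<tau> *\<^sub>R g \<tau>) = (LINT \<tau>|lborel. LINT s|lborel. k s \<tau> *\<^sub>R g \<tau>)"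
    by simp
  moreover have "(LINT s|lborel. k s \<tau> *\<^sub>R g \<tau>) = ?C *\<^sub>R (indicator {..<t} \<tau> *\<^sub>R g \<tau>)" for \<tau>
  proof -
    have meas: "(\<lambda>s. k s \<tau>) \<in> borel_measurable lborel" by (simp add: k_def)
    have "integrable lborel (\<lambda>s. k s \<tau>)"
      using k0 by (intro integrableI_nonneg meas) (auto simp: kI)
    moreover have "(LINT s|lborel. k s \<tau>) = ?C * indicator {..<t} \<tau>"
      using k0 C by (subst integral_eq_nn_integral[OF meas]) (auto simp: kI)
    ultimately show ?thesis by simp
  qed
  moreover have "(LINT \<tau>|lborel. k s \<tau> *\<^sub>R g \<tau>)
      = abel_kernel \<alpha> (t - s) *\<^sub>R (LINT \<tau>|lborel. abel_kernel (1 - \<alpha>) (s - \<tau>) *\<^sub>R g \<tau>)" for s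
    unfolding k_def scaleR_scaleR[symmetric] by (rule integral_scaleR_right)
  ultimately show ?thesis by (simp only: integral_scaleR_right)
qed

section \<open>Young's inequality for the Abel kernel\<close>

text \<open>The kernel is split into its powers 1 - 1/p and 1/p. Hoelder's inequality then bounds
  v(t)^p by K^(p-1) times the kernel integral of h^p, and Tonelli's theorem integrates the kernel in
  the other variable, which gives the last factor \<open>K\<close>.\<close>

lemma abel_Young:
  fixes v h :: "real \<Rightarrow> real"
  assumes "a < b" "0 < \<alpha>" "1 < p"
    and [measurable]: "h \<in> borel_measurable borel"
    and nonneg: "\<And>s. 0 \<le> h s" "\<And>t. 0 \<le> v t" and supp: "\<And>s. s \<le> a \<Longrightarrow> h s = 0"
    and v: "\<And>t. a < t \<Longrightarrow> t < b \<Longrightarrow> ennreal (v t) \<le> (\<integral>\<^sup>+s. ennreal (abel_kernel \<alpha> (t - s) * h s) \<partial>lborel)"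
  shows "(\<integral>\<^sup>+t\<in>{a<..<b}. ennreal (v t powr p) \<partial>lborel)
    \<le> ennreal (((b - a) powr \<alpha> / \<alpha>) powr p) * (\<integral>\<^sup>+s\<in>{a<..<b}. ennreal (h s powr p) \<partial>lborel)"
proof -
  define K where "K = (b - a) powr \<alpha> / \<alpha>"
  have K: "K > 0" using assms(1,2) by (simp add: K_def)
  define \<theta> where "\<theta> = 1 - 1 / p"
  have \<theta>: "0 < \<theta>" "\<theta> < 1" "1 - \<theta> = 1 / p" using \<open>1 < p\<close> by (auto simp: \<theta>_def)
  have kernel: "(\<integral>\<^sup>+s\<in>{a<..<b}. ennreal (abel_kernel \<alpha> (t - s)) \<partial>lborel) \<le> ennreal K"
    "(\<integral>\<^sup>+s\<in>{a<..<b}. ennreal (abel_kernel \<alpha> (s - t)) \<partial>lborel) \<le> ennreal K" if t: "a < t" "t < b" for t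
  proof -
    have "(\<integral>\<^sup>+s\<in>{a<..<b}. ennreal (abel_kernel \<alpha> (t - s)) \<partial>lborel)
        = ennreal \<bar>-1\<bar> * (\<integral>\<^sup>+x. ennreal (abel_kernel \<alpha> (t - (t + (-1) * x))) * indicator {a<..<b} (t + (-1) * x) \<partial>lborel)"
      by (intro nn_integral_real_affine) auto
    also have "\<dots> \<le> (\<integral>\<^sup>+x\<in>{..b - a}. ennreal (abel_kernel \<alpha> x) \<partial>lborel)"
      using t by (simp, intro nn_integral_mono) (auto simp: indicator_def)
    also have "\<dots> = ennreal K" using assms(1,2) by (simp add: nn_integral_abel_kernel K_def)
    finally show "(\<integral>\<^sup>+s\<in>{a<..<b}. ennreal (abel_kernel \<alpha> (t - s)) \<partial>lborel) \<le> ennreal K" .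
    have "(\<integral>\<^sup>+s\<in>{a<..<b}. ennreal (abel_kernel \<alpha> (s - t)) \<partial>lborel)
        = ennreal \<bar>1\<bar> * (\<integral>\<^sup>+x. ennreal (abel_kernel \<alpha> ((t + 1 * x) - t)) * indicator {a<..<b} (t + 1 * x) \<partial>lborel)"
      by (intro nn_integral_real_affine) auto
    also have "\<dots> \<le> (\<integral>\<^sup>+x\<in>{..b - a}. ennreal (abel_kernel \<alpha> x) \<partial>lborel)"
      using t by (simp, intro nn_integral_mono) (auto simp: indicator_def)
    also have "\<dots> = ennreal K" using assms(1,2) by (simp add: nn_integral_abel_kernel K_def)
    finally show "(\<integral>\<^sup>+s\<in>{a<..<b}. ennreal (abel_kernel \<alpha> (s - t)) \<partial>lborel) \<le> ennreal K" .
  qed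
  have pointwise: "ennreal (v t powr p) \<le> ennreal (K powr (p - 1)) *
      (\<integral>\<^sup>+s. ennreal (abel_kernel \<alpha> (t - s) * h s powr p) * indicator {a<..<b} s \<partial>lborel)" if t: "a < t" "t < b" for t
  proof -
    \<comment> \<open>Cutting the kernel to (a, b) loses nothing: \<open>h\<close> vanishes up to
      \<open>a\<close>, and the kernel vanishes for s \<ge> t.\<close>
    define f where "f s = abel_kernel \<alpha> (t - s) * indicator {a<..<b} s" for s
    have [measurable]: "f \<in> borel_measurable borel" unfolding f_def by measurable
    have f0: "0 \<le> f s" for s by (simp add: f_def)
    have "ennreal (v t) \<le> (\<integral>\<^sup>+s. ennreal (abel_kernel \<alpha> (t - s) * h s) \<partial>lborel)"
      by (rule v[OF t])
    also have "\<dots> = (\<integral>\<^sup>+s. ennreal (f s powr \<theta> * (f s * h s powr p) powr (1 - \<theta>)) \<partial>lborel)"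
    proof (rule nn_integral_cong)
      fix s
      have "f s powr \<theta> * (f s * h s powr p) powr (1 - \<theta>) = f s powr (\<theta> + (1 - \<theta>)) * h s"
        using f0[of s] nonneg(1)[of s] \<open>1 < p\<close>
        by (simp add: powr_mult powr_powr \<theta>(3) powr_add del: add_diff_cancel_left' diff_add_cancel)
      also have "\<dots> = abel_kernel \<alpha> (t - s) * h s"
        using supp[of s] t f0[of s] by (auto simp: f_def indicator_def abel_kernel_def)
      finally show "ennreal (abel_kernel \<alpha> (t - s) * h s) = ennreal (f s powr \<theta> * (f s * h s powr p) powr (1 - \<theta>))"
        by simp
    qed
    also have "\<dots> \<le> ennreal_powr (\<integral>\<^sup>+s. ennreal (f s) \<partial>lborel) \<theta> * ennreal_powr (\<integral>\<^sup>+s. ennreal (f s * h s powr p) \<partial>lborel) (1 - \<theta>)"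
      using f0 \<theta> by (intro nn_integral_Hoelder) auto
    also have "\<dots> \<le> ennreal_powr (ennreal K) \<theta> * ennreal_powr (\<integral>\<^sup>+s. ennreal (f s * h s powr p) \<partial>lborel) (1 - \<theta>)"
    proof (intro mult_right_mono ennreal_powr_mono)
      have "(\<integral>\<^sup>+s. ennreal (f s) \<partial>lborel) = (\<integral>\<^sup>+s\<in>{a<..<b}. ennreal (abel_kernel \<alpha> (t - s)) \<partial>lborel)"
        by (intro nn_integral_cong) (auto simp: f_def indicator_def)
      then show "(\<integral>\<^sup>+s. ennreal (f s) \<partial>lborel) \<le> ennreal K" using kernel(1)[OF t] by simp
    qed (use \<theta> in auto)
    finally have "ennreal_powr (ennreal (v t)) p
        \<le> ennreal_powr (ennreal_powr (ennreal K) \<theta> * ennreal_powr (\<integral>\<^sup>+s. ennreal (f s * h s powr p) \<partial>lborel) (1 - \<theta>)) p"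
      using \<open>1 < p\<close> by (intro ennreal_powr_mono) auto
    also have "\<dots> = ennreal_powr (ennreal K) (\<theta> * p) * ennreal_powr (\<integral>\<^sup>+s. ennreal (f s * h s powr p) \<partial>lborel) ((1 - \<theta>) * p)"
      using \<open>1 < p\<close> \<theta>(1,2) by (simp add: ennreal_powr_mult ennreal_powr_powr)
    also have "(1 - \<theta>) * p = 1" using \<open>1 < p\<close> \<theta>(3) by simp
    also have "\<theta> * p = p - 1" using \<open>1 < p\<close> by (simp add: \<theta>_def algebra_simps)
    finally have "ennreal (v t powr p) \<le> ennreal (K powr (p - 1)) * (\<integral>\<^sup>+s. ennreal (f s * h s powr p) \<partial>lborel)"
      using nonneg(2)[of t] K \<open>1 < p\<close> by (simp add: ennreal_powr_ennreal)
    also have "(\<integral>\<^sup>+s. ennreal (f s * h s powr p) \<partial>lborel)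
        = (\<integral>\<^sup>+s. ennreal (abel_kernel \<alpha> (t - s) * h s powr p) * indicator {a<..<b} s \<partial>lborel)"
      by (intro nn_integral_cong) (auto simp: f_def indicator_def)
    finally show ?thesis .
  qed
  have "(\<integral>\<^sup>+t\<in>{a<..<b}. ennreal (v t powr p) \<partial>lborel)
      \<le> (\<integral>\<^sup>+t. \<integral>\<^sup>+s. ennreal (K powr (p - 1)) * (ennreal (abel_kernel \<alpha> (t - s) * h s powr p) * indicator {a<..<b} s) * indicator {a<..<b} t \<partial>lborel \<partial>lborel)"
  proof (rule nn_integral_mono)
    fix t
    have "(\<integral>\<^sup>+s. ennreal (K powr (p - 1)) * (ennreal (abel_kernel \<alpha> (t - s) * h s powr p) * indicator {a<..<b} s) * indicator {a<..<b} t \<partial>lborel)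
      = ennreal (K powr (p - 1)) * (\<integral>\<^sup>+s. ennreal (abel_kernel \<alpha> (t - s) * h s powr p) * indicator {a<..<b} s \<partial>lborel) * indicator {a<..<b} t"
      by (subst nn_integral_multc, measurable) (subst nn_integral_cmult, auto)
    then show "ennreal (v t powr p) * indicator {a<..<b} t \<le>
       (\<integral>\<^sup>+s. ennreal (K powr (p - 1)) * (ennreal (abel_kernel \<alpha> (t - s) * h s powr p) * indicator {a<..<b} s) * indicator {a<..<b} t \<partial>lborel)"
      using pointwise[of t] by (auto simp: indicator_def)
  qed
  also have "\<dots> = (\<integral>\<^sup>+s. \<integral>\<^sup>+t. ennreal (K powr (p - 1)) * (ennreal (abel_kernel \<alpha> (t - s) * h s powr p) * indicator {a<..<b} s) * indicator {a<..<b} t \<partial>lborel \<partial>lborel)"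
    by (rule lborel_pair.Fubini'[symmetric]) measurable
  also have "\<dots> \<le> (\<integral>\<^sup>+s. ennreal (K powr p) * (ennreal (h s powr p) * indicator {a<..<b} s) \<partial>lborel)"
  proof (rule nn_integral_mono)
    fix s
    have "(\<integral>\<^sup>+t. ennreal (K powr (p - 1)) * (ennreal (abel_kernel \<alpha> (t - s) * h s powr p) * indicator {a<..<b} s) * indicator {a<..<b} t \<partial>lborel)
      = (\<integral>\<^sup>+t. (ennreal (K powr (p - 1)) * (ennreal (h s powr p) * indicator {a<..<b} s)) * (ennreal (abel_kernel \<alpha> (t - s)) * indicator {a<..<b} t) \<partial>lborel)"
      by (intro nn_integral_cong) (simp add: ennreal_mult' mult_ac)
    also have "\<dots> = (ennreal (K powr (p - 1)) * (ennreal (h s powr p) * indicator {a<..<b} s)) * (\<integral>\<^sup>+t\<in>{a<..<b}. ennreal (abel_kernel \<alpha> (t - s)) \<partial>lborel)"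
      by (rule nn_integral_cmult) measurable
    also have "\<dots> \<le> (ennreal (K powr (p - 1)) * (ennreal (h s powr p) * indicator {a<..<b} s)) * ennreal K"
      using kernel(2)[of s] by (cases "s \<in> {a<..<b}") (auto intro!: mult_left_mono)
    also have "\<dots> = (ennreal (K powr (p - 1)) * ennreal K) * (ennreal (h s powr p) * indicator {a<..<b} s)"
      by (simp add: mult_ac)
    also have "ennreal (K powr (p - 1)) * ennreal K = ennreal (K powr p)"
      using K by (simp add: ennreal_mult[symmetric] powr_diff)
    finally show "(\<integral>\<^sup>+t. ennreal (K powr (p - 1)) * (ennreal (abel_kernel \<alpha> (t - s) * h s powr p) * indicator {a<..<b} s) * indicator {a<..<b} t \<partial>lborel)
      \<le> ennreal (K powr p) * (ennreal (h s powr p) * indicator {a<..<b} s)" .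
  qed
  also have "\<dots> = ennreal (K powr p) * (\<integral>\<^sup>+s\<in>{a<..<b}. ennreal (h s powr p) \<partial>lborel)"
    by (rule nn_integral_cmult) measurable
  finally show ?thesis by (simp add: K_def)
qed

section \<open>The Caputo derivative and its inversion\<close>

text \<open>\<open>D\<close> is a Borel version of the Caputo derivative, built from the density of
  \<open>u\<close> and defined on the whole line. The two agree at every \<open>t\<close> in (a, b):
  Bochner integrals of integrands equal almost everywhere coincide, also in the default value
  0.\<close>

lemma left_Caputo_deriv_representation:
  fixes u :: "real \<Rightarrow> 'a::euclidean_space"
  assumes "a < b" "absolutely_continuous_on a b u" "u a = 0" and \<alpha>: "0 < \<alpha>" "\<alpha> < 1"
  obtains D :: "real \<Rightarrow> 'a" where "D \<in> borel_measurable borel" "\<And>s. s \<le> a \<Longrightarrow> D s = 0"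
    "\<And>t. a < t \<Longrightarrow> t < b \<Longrightarrow> left_Caputo_deriv \<alpha> a u t = D t"
    "\<And>t. a < t \<Longrightarrow> t < b \<Longrightarrow> u t = (1 / Gamma \<alpha>) *\<^sub>R (LINT s|lborel. abel_kernel \<alpha> (t - s) *\<^sub>R D s)"
proof -
  obtain g0 :: "real \<Rightarrow> 'a" and N where g0: "integrable lborel g0" "negligible N"
    "\<And>t. a \<le> t \<Longrightarrow> t \<le> b \<Longrightarrow> u t - u a = (LINT s:{a..t}|lborel. g0 s)"
    "\<And>t. a < t \<Longrightarrow> t < b \<Longrightarrow> t \<notin> N \<Longrightarrow> vector_derivative u (at t) = g0 t"
    using absolutely_continuous_ftc[OF assms(1,2)] by blast
  \<comment> \<open>The cut to (a, b) replaces integrals from \<open>a\<close> by integrals over the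
    whole line and makes \<open>D\<close> vanish up to \<open>a\<close>.\<close>
  define g where "g s = indicator {a<..<b} s *\<^sub>R g0 s" for s
  have g: "integrable lborel g"
    unfolding g_def by (rule integrable_mult_indicator[OF _ g0(1)]) simp
  have [measurable]: "g \<in> borel_measurable borel" using borel_measurable_integrable[OF g] by simp
  define D where "D t = (1 / Gamma (1 - \<alpha>)) *\<^sub>R (LINT s|lborel. abel_kernel (1 - \<alpha>) (t - s) *\<^sub>R g s)" for t
  have Gamma_pos: "Gamma \<alpha> > 0" "Gamma (1 - \<alpha>) > 0" using \<alpha> by (auto intro: Gamma_real_pos)
  show ?thesis
  proof (rule that[of D])
    show "D \<in> borel_measurable borel" unfolding D_def by measurable
    have "(LINT \<tau>|lborel. abel_kernel (1 - \<alpha>) (s - \<tau>) *\<^sub>R g \<tau>) = 0" if "s \<le> a" for s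
    proof -
      have "abel_kernel (1 - \<alpha>) (s - \<tau>) *\<^sub>R g \<tau> = 0" for \<tau>
        using that by (simp add: abel_kernel_def g_def indicator_def)
      then show ?thesis by (simp only:) simp
    qed
    then show "D s = 0" if "s \<le> a" for s using that by (simp add: D_def)
    show "left_Caputo_deriv \<alpha> a u t = D t" if t: "a < t" "t < b" for t
    proof -
      \<comment> \<open>The endpoints are discarded together with \<open>N\<close>; in particular
        the two-sided derivative of \<open>u\<close> at \<open>a\<close> is not controlled.\<close>
      have "AE s in lebesgue. s \<notin> N \<union> {a, t}"
        using g0(2) by (intro AE_not_in) (simp add: negligible_iff_null_sets[symmetric])
      then have AE: "AE s in lebesgue. abel_kernel (1 - \<alpha>) (t - s) *\<^sub>R g s =
          indicator {a..t} s *\<^sub>R ((t - s) powr (- \<alpha>) *\<^sub>R vector_derivative u (at s))"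
      proof eventually_elim
        case (elim s)
        then show ?case using t g0(4)[of s] by (auto simp: abel_kernel_def g_def indicator_def)
      qed
      have meas: "(\<lambda>s. abel_kernel (1 - \<alpha>) (t - s) *\<^sub>R g s) \<in> borel_measurable lborel" by measurable
      have "(LINT s:{a..t}|lebesgue. (t - s) powr (- \<alpha>) *\<^sub>R vector_derivative u (at s))
          = (LINT s|lebesgue. abel_kernel (1 - \<alpha>) (t - s) *\<^sub>R g s)"
        unfolding set_lebesgue_integral_def
      proof (rule integral_cong_AE[symmetric])
        show m: "(\<lambda>s. abel_kernel (1 - \<alpha>) (t - s) *\<^sub>R g s) \<in> borel_measurable lebesgue"
          using meas by (rule measurable_completion)
        \<comment> \<open>Lebesgue measure is complete, so the integrand with the true derivative
          inherits measurability from its Borel version.\<close>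
        show "(\<lambda>s. indicator {a..t} s *\<^sub>R ((t - s) powr (- \<alpha>) *\<^sub>R vector_derivative u (at s))) \<in> borel_measurable lebesgue"
          by (rule borel_measurable_AE[OF m AE])
      qed (rule AE)
      also have "\<dots> = (LINT s|lborel. abel_kernel (1 - \<alpha>) (t - s) *\<^sub>R g s)"
        by (rule integral_completion[OF meas])
      finally show ?thesis
        by (simp add: left_Caputo_deriv_def left_RL_integral_def D_def)
    qed
    show "u t = (1 / Gamma \<alpha>) *\<^sub>R (LINT s|lborel. abel_kernel \<alpha> (t - s) *\<^sub>R D s)" if t: "a < t" "t < b" for t
    proof -
      have "(LINT s|lborel. abel_kernel \<alpha> (t - s) *\<^sub>R D s) = (1 / Gamma (1 - \<alpha>)) *\<^sub>R
         (LINT s|lborel. abel_kernel \<alpha> (t - s) *\<^sub>R (LINT \<tau>|lborel. abel_kernel (1 - \<alpha>) (s - \<tau>) *\<^sub>R g \<tau>))"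
        unfolding D_def integral_scaleR_right[symmetric] by (simp add: mult.commute)
      also have "\<dots> = Gamma \<alpha> *\<^sub>R (LINT \<tau>|lborel. indicator {..<t} \<tau> *\<^sub>R g \<tau>)"
        unfolding abel_inversion[OF \<alpha> g] using Gamma_pos by simp
      also have "(LINT \<tau>|lborel. indicator {..<t} \<tau> *\<^sub>R g \<tau>) = (LINT \<tau>:{a..t}|lborel. g0 \<tau>)"
        unfolding set_lebesgue_integral_def
      proof (rule integral_cong_AE)
        show "AE \<tau> in lborel. indicator {..<t} \<tau> *\<^sub>R g \<tau> = indicator {a..t} \<tau> *\<^sub>R g0 \<tau>"
          using AE_lborel_singleton[of a] AE_lborel_singleton[of t]
          by eventually_elim (use t in \<open>auto simp: g_def indicator_def\<close>)
      qed (use borel_measurable_integrable[OF g0(1)] in auto)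
      \<comment> \<open>Here \<open>u a = 0\<close> enters: the indefinite integral is
        \<open>u\<close> itself.\<close>
      also have "\<dots> = u t" using g0(3)[of t] t assms(3) by simp
      finally show ?thesis using Gamma_pos by simp
    qed
  qed
qed

text \<open>\<open>K\<close> is the integral over (0, b - a) of the kernel of the fractional
  integral of order \<alpha>, Gamma factor included, and so does not depend on
  \<open>u\<close>.\<close>

lemma Lp_norm_le_left_Caputo_deriv:
  fixes a b :: real
  assumes "a < b" "0 < \<alpha>" "\<alpha> < 1" "1 < p"
  obtains K where "0 < K" "\<And>u :: real \<Rightarrow> 'a::euclidean_space. absolutely_continuous_on a b u \<Longrightarrow> u a = 0 \<Longrightarrow>
    Lp_norm p a b u \<le> ennreal K * Lp_norm p a b (left_Caputo_deriv \<alpha> a u)"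
proof -
  define K where "K = (b - a) powr \<alpha> / \<alpha> / Gamma \<alpha>"
  have Gamma_pos: "Gamma \<alpha> > 0" using assms by (auto intro: Gamma_real_pos)
  have "K > 0" using assms Gamma_pos by (simp add: K_def)
  moreover have "Lp_norm p a b u \<le> ennreal K * Lp_norm p a b (left_Caputo_deriv \<alpha> a u)"
    if u: "absolutely_continuous_on a b u" "u a = 0" for u :: "real \<Rightarrow> 'a"
  proof -
    obtain D :: "real \<Rightarrow> 'a" where D: "D \<in> borel_measurable borel" "\<And>s. s \<le> a \<Longrightarrow> D s = 0"
      "\<And>t. a < t \<Longrightarrow> t < b \<Longrightarrow> left_Caputo_deriv \<alpha> a u t = D t"
      "\<And>t. a < t \<Longrightarrow> t < b \<Longrightarrow> u t = (1 / Gamma \<alpha>) *\<^sub>R (LINT s|lborel. abel_kernel \<alpha> (t - s) *\<^sub>R D s)"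
      using left_Caputo_deriv_representation[OF assms(1) u assms(2,3)] by blast
    define h where "h s = norm (D s) / Gamma \<alpha>" for s
    have [measurable]: "h \<in> borel_measurable borel" unfolding h_def using D(1) by measurable
    have "ennreal (norm (u t)) \<le> (\<integral>\<^sup>+s. ennreal (abel_kernel \<alpha> (t - s) * h s) \<partial>lborel)" if t: "a < t" "t < b" for t
    proof -
      let ?f = "\<lambda>s. (1 / Gamma \<alpha>) *\<^sub>R (abel_kernel \<alpha> (t - s) *\<^sub>R D s)"
      have "u t = (LINT s|lborel. ?f s)"
        unfolding integral_scaleR_right by (rule D(4)[OF t])
      moreover have "ennreal (norm (LINT s|lborel. ?f s)) \<le> (\<integral>\<^sup>+s. ennreal (norm (?f s)) \<partial>lborel)"
      \<comment> \<open>If the Bochner integral does not exist, it is 0 by convention and the bound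
        is trivial.\<close>
      proof (cases "integrable lborel ?f")
        case False
        then have "(LINT s|lborel. ?f s) = 0" by (rule not_integrable_integral_eq)
        then show ?thesis by (simp only:) simp
      qed (rule integral_norm_bound_ennreal)
      moreover have "norm (?f s) = abel_kernel \<alpha> (t - s) * h s" for s
        using Gamma_pos by (simp add: h_def)
      ultimately show ?thesis by (simp only:)
    qed
    then have "(\<integral>\<^sup>+t\<in>{a<..<b}. ennreal (norm (u t) powr p) \<partial>lborel)
      \<le> ennreal (((b - a) powr \<alpha> / \<alpha>) powr p) * (\<integral>\<^sup>+s\<in>{a<..<b}. ennreal (h s powr p) \<partial>lborel)"
      using Gamma_pos D(2) assms by (intro abel_Young \<open>h \<in> borel_measurable borel\<close>) (auto simp: h_def)
    then have "Lp_norm p a b u \<le> ennreal_powr (ennreal (((b - a) powr \<alpha> / \<alpha>) powr p) * (\<integral>\<^sup>+s\<in>{a<..<b}. ennreal (h s powr p) \<partial>lborel)) (1 / p)"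
      unfolding Lp_norm_lborel using assms by (intro ennreal_powr_mono) auto
    also have "\<dots> = ennreal ((b - a) powr \<alpha> / \<alpha>) * Lp_norm p a b h"
      using assms Gamma_pos by (simp add: ennreal_powr_mult ennreal_powr_ennreal powr_powr Lp_norm_lborel h_def)
    also have "\<dots> \<le> ennreal ((b - a) powr \<alpha> / \<alpha>) * (ennreal (1 / Gamma \<alpha>) * Lp_norm p a b D)"
      using D(1) Gamma_pos assms by (intro mult_left_mono Lp_norm_le_scale) (auto simp: h_def)
    also have "\<dots> = ennreal K * Lp_norm p a b D"
      using assms Gamma_pos by (simp add: K_def mult.assoc[symmetric] ennreal_mult[symmetric])
    also have "Lp_norm p a b D = Lp_norm p a b (left_Caputo_deriv \<alpha> a u)"
      by (rule Lp_norm_cong) (simp add: D(3))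
    finally show ?thesis .
  qed
  ultimately show ?thesis using that by blast
qed

section \<open>The weighted interpolation inequality\<close>

theorem theorem3p12:
  fixes a b p q r \<alpha> \<delta> c d e :: real
  assumes "0 < a" and "a < b"
    and "1 < p" and "1 < q"
    and "\<alpha> \<in> {1 - 1/q<..<1}"
    and "0 < r" and "p + q \<ge> r"
    and "\<delta> \<in> {0..1} \<inter> {(r - q) / r..p / r}"
    and "\<delta> / p + (1 - \<delta>) / q = 1 / r"
    and "c = \<delta> * (d - 1) + e * (1 - \<delta>)"
    and "1 + (d - 1) * p > 0"
  shows "\<exists>C::real. C > 0 \<and>
    (\<forall>u :: real \<Rightarrow> 'a::{real_normed_field, euclidean_space}.
       absolutely_continuous_on a b u \<and> u a = 0 \<longrightarrow>
       Lp_norm r a b (\<lambda>x. (x powr c) *\<^sub>R u x)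
         \<le> ennreal C
           * ennreal_powr (Lp_norm p a b (\<lambda>x. (x powr d) *\<^sub>R left_Caputo_deriv \<alpha> a u x)) \<delta>
           * ennreal_powr (Lp_norm q a b (\<lambda>x. (x powr e) *\<^sub>R u x)) (1 - \<delta>))"
proof -
  \<comment> \<open>\<alpha> is positive because q > 1 makes 1 - 1/q positive.\<close>
  have \<alpha>: "0 < \<alpha>" "\<alpha> < 1"
    using assms(4,5) less_trans[of 0 "1 - 1 / q" \<alpha>] by auto
  have \<delta>: "0 \<le> \<delta>" "\<delta> \<le> 1" using assms(8) by auto
  have pq: "0 < p" "0 < q" using assms(3,4) by auto
  obtain K where K: "0 < K" "\<And>u :: real \<Rightarrow> 'a. absolutely_continuous_on a b u \<Longrightarrow> u a = 0 \<Longrightarrow>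
      Lp_norm p a b u \<le> ennreal K * Lp_norm p a b (left_Caputo_deriv \<alpha> a u)"
    using Lp_norm_le_left_Caputo_deriv[OF assms(2) \<alpha> assms(3)] by metis
  obtain A where A: "0 < A" "\<And>f :: real \<Rightarrow> 'a. (\<lambda>x. indicator {a<..<b} x * norm (f x)) \<in> borel_measurable borel \<Longrightarrow>
      Lp_norm r a b (\<lambda>x. (x powr c) *\<^sub>R f x) \<le> ennreal A * Lp_norm r a b f"
    using weighted_Lp_norm_bounds[OF assms(1,2,6), of c] by metis
  obtain B where B: "0 < B" "\<And>f :: real \<Rightarrow> 'a. (\<lambda>x. indicator {a<..<b} x * norm (f x)) \<in> borel_measurable borel \<Longrightarrow>
      Lp_norm p a b f \<le> ennreal B * Lp_norm p a b (\<lambda>x. (x powr d) *\<^sub>R f x)"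
    using weighted_Lp_norm_bounds[OF assms(1,2) pq(1), of d] by metis
  obtain E where E: "0 < E" "\<And>f :: real \<Rightarrow> 'a. (\<lambda>x. indicator {a<..<b} x * norm (f x)) \<in> borel_measurable borel \<Longrightarrow>
      Lp_norm q a b f \<le> ennreal E * Lp_norm q a b (\<lambda>x. (x powr e) *\<^sub>R f x)"
    using weighted_Lp_norm_bounds[OF assms(1,2) pq(2), of e] by metis
  \<comment> \<open>\<open>A\<close>, \<open>B\<close> and \<open>E\<close> account for the weights
    with exponents \<open>c\<close>, \<open>d\<close> and \<open>e\<close>, and \<open>K\<close> for
    passing from \<open>u\<close> to its Caputo derivative; the powers are those of the
    interpolation.\<close>
  define C where "C = A * ((K * B) powr \<delta> * E powr (1 - \<delta>))"
  show ?thesis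
  proof (intro exI[of _ C] conjI allI impI)
    show "C > 0" using K(1) A(1) B(1) E(1) by (simp add: C_def)
    fix u :: "real \<Rightarrow> 'a"
    assume u: "absolutely_continuous_on a b u \<and> u a = 0"
    let ?D = "left_Caputo_deriv \<alpha> a u"
    \<comment> \<open>Continuity of \<open>u\<close> is known on the closed interval only, so
      measurability is derived for its cut-off.\<close>
    have "(\<lambda>x. indicator {a..b} x *\<^sub>R u x) \<in> borel_measurable borel"
      using small_variation_continuous_on[OF absolutely_continuous_on_small_variation] u
      by (intro borel_measurable_continuous_on_indicator) auto
    then have "(\<lambda>x. indicator {a<..<b} x * norm (indicator {a..b} x *\<^sub>R u x)) \<in> borel_measurable borel"
      by measurable
    moreover have "indicator {a<..<b} x * norm (indicator {a..b} x *\<^sub>R u x) = indicator {a<..<b} x * norm (u x)" for x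
      by (simp add: indicator_def)
    ultimately have meas_u: "(\<lambda>x. indicator {a<..<b} x * norm (u x)) \<in> borel_measurable borel"
      by (simp only:)
    \<comment> \<open>The Borel version \<open>D\<close> supplies measurability of the Caputo
      derivative inside (a, b).\<close>
    obtain D :: "real \<Rightarrow> 'a" where D: "D \<in> borel_measurable borel"
      "\<And>t. a < t \<Longrightarrow> t < b \<Longrightarrow> ?D t = D t"
      using left_Caputo_deriv_representation[OF assms(2) _ _ \<alpha>, of u] u by metis
    have "(\<lambda>x. indicator {a<..<b} x * norm (D x)) \<in> borel_measurable borel"
      using D(1) by measurable
    moreover have "indicator {a<..<b} x * norm (D x) = indicator {a<..<b} x * norm (?D x)" for x
      using D(2)[of x] by (simp add: indicator_def)
    ultimately have meas_D: "(\<lambda>x. indicator {a<..<b} x * norm (?D x)) \<in> borel_measurable borel"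
      by (simp only:)
    let ?P = "Lp_norm p a b (\<lambda>x. (x powr d) *\<^sub>R ?D x)" and ?Q = "Lp_norm q a b (\<lambda>x. (x powr e) *\<^sub>R u x)"
    have "Lp_norm p a b u \<le> ennreal K * Lp_norm p a b ?D"
      using K(2) u by blast
    also have "\<dots> \<le> ennreal K * (ennreal B * ?P)"
      by (intro mult_left_mono B(2)[OF meas_D]) simp
    also have "\<dots> = ennreal (K * B) * ?P"
      using K(1) B(1) by (simp add: ennreal_mult mult.assoc)
    finally have P: "Lp_norm p a b u \<le> ennreal (K * B) * ?P" .
    have "Lp_norm r a b (\<lambda>x. (x powr c) *\<^sub>R u x) \<le> ennreal A * Lp_norm r a b u"
      by (rule A(2)[OF meas_u])
    also have "\<dots> \<le> ennreal A * (ennreal_powr (Lp_norm p a b u) \<delta> * ennreal_powr (Lp_norm q a b u) (1 - \<delta>))"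
      by (intro mult_left_mono Lp_norm_interpolation pq assms(6,9) \<delta> meas_u) simp
    also have "\<dots> \<le> ennreal A * (ennreal_powr (ennreal (K * B) * ?P) \<delta> * ennreal_powr (ennreal E * ?Q) (1 - \<delta>))"
      using \<delta> by (intro mult_left_mono mult_mono ennreal_powr_mono P E(2)[OF meas_u]) auto
    \<comment> \<open>\<open>ennreal_powr_pos\<close> covers the exponent 0 as well: for positive
      constants \<open>powr\<close> also gives 1.\<close>
    also have "\<dots> = ennreal C * ennreal_powr ?P \<delta> * ennreal_powr ?Q (1 - \<delta>)"
      using \<delta> K(1) A(1) B(1) E(1)
      by (simp add: C_def ennreal_powr_mult ennreal_powr_pos ennreal_mult powr_mult mult_ac)
    finally show "Lp_norm r a b (\<lambda>x. (x powr c) *\<^sub>R u x)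
        \<le> ennreal C * ennreal_powr ?P \<delta> * ennreal_powr ?Q (1 - \<delta>)" .
  qed
qed

end
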